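(* Let $(\mathfrak{g},\langle\,,\rangle)$ be a flat pseudo-Euclidean nilpotent Lie algebra of signature $(2,n-2)$, where $n=\dim\mathfrak{g}\ge 4$. Then $(\mathfrak{g},\langle\,,\rangle)$ is (up to isometric isomorphism) a double extension of a flat Lorentzian nilpotent Lie algebra according to some admissible $(\xi,D,\mu,b_0)$ with $\mu=0$ and $D$ a nilpotent endomorphism.
   Context: A pseudo-Euclidean Lie algebra $(\mathfrak{g},\langle\,,\rangle)$ is a finite-dimensional real Lie algebra with a non-degenerate symmetric bilinear form. Its Levi-Civita product $(u,v)\mapsto u.v$ is defined by $2\langle u.v,w\rangle=\langle[u,v],w\rangle+\langle[w,u],v\rangle+\langle[w,v],u\rangle$. Write $\mathrm{L}_u v=u.v$ and $\mathrm{R}_uv=v.u$. It is flat if the Levi-Civita product is left symmetric: $(u.v).w-u.(v.w)=(v.u).w-v.(u.w)$ for all $u,v,w$; equivalently $\mathrm{L}_{[u,v]}=[\mathrm{L}_u,\mathrm{L}_v]$. Signature $(p,q)$ means $p$ negative and $q$ positive directions; a Lie algebra of dimension $m$ is Lorentzian if its form has signature $(1,m-1)$. Double extension. Let $(B,[\,,]_0,\langle\,,\rangle_0)$ be a flat pseudo-Euclidean Lie algebra with Levi-Civita product written $a.b$, let $\xi,D:B\to B$ be endomorphisms, $b_0\in B$, $\mu\in\mathbb{R}$. The quadruple $(\xi,D,\mu,b_0)$ is admissible if: (1) $\xi([a,b]_0)=\mathrm{L}_a\xi(b)-\mathrm{L}_b\xi(a)$ for all $a,b\in B$; (2) $D-\xi$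 is skew-symmetric with respect to $\langle\,,\rangle_0$, $[D,\xi]=\xi^2-\mu\xi-\mathrm{R}_{b_0}$, and $a.\xi(b)-\xi(a.b)=D(a).b+a.D(b)-D(a.b)$ for all $a,b\in B$. Given an admissible $(\xi,D,\mu,b_0)$, the double extension of $(B,[\,,]_0,\langle\,,\rangle_0)$ according to $(\xi,D,\mu,b_0)$ is the vector space $\mathbb{R}e\oplus B\oplus\mathbb{R}\bar e$ with the form $\langle\,,\rangle$ extending $\langle\,,\rangle_0$, for which $\mathrm{span}\{e,\bar e\}$ and $B$ are orthogonal, $\langle e,e\rangle=\langle\bar e,\bar e\rangle=0$, $\langle e,\bar e\rangle=1$, and with the bracket $[\bar e,e]=\mu e$, $[\bar e,a]=D(a)-\langle b_0,a\rangle_0e$, $[a,b]=[a,b]_0+\langle(\xi-\xi^* )(a),b\rangle_0e$ for $a,b\in B$, where $\xi^*$ is the adjoint of $\xi$ with respect to $\langle\,,\rangle_0$; this is a flat pseudo-Euclidean Lie algebra. *)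

theory Defs
  imports "HOL-Analysis.Analysis"
begin

text \<open>
  A Lie algebra with a bilinear form is a record whose carrier is a linear subspace of an ambient
  real vector space; bracket and form are only meaningful on the carrier. Working with carriers
  rather than types makes it possible to assert the existence of a Lie algebra of another dimension.
\<close>

record 'a form_lie_algebra =
  carrier :: "'a set"
  bracket :: "'a \<Rightarrow> 'a \<Rightarrow> 'a"
  form :: "'a \<Rightarrow> 'a \<Rightarrow> real"

definition linear_between ::
  "'a::real_vector set \<Rightarrow> 'b::real_vector set \<Rightarrow> ('a \<Rightarrow> 'b) \<Rightarrow> bool" where
  "linear_between V W f \<longleftrightarrow>
     (\<forall>x\<in>V. f x \<in> W) \<and>
     (\<forall>x\<in>V. \<forall>y\<in>V. f (x + y) = f x + f y) \<and>
     (\<forall>c. \<forall>x\<in>V. f (c *\<^sub>R x) = c *\<^sub>R f x)"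

definition bilinear_between ::
  "'a::real_vector set \<Rightarrow> 'b::real_vector set \<Rightarrow> ('a \<Rightarrow> 'a \<Rightarrow> 'b) \<Rightarrow> bool" where
  "bilinear_between V W f \<longleftrightarrow>
     (\<forall>x\<in>V. linear_between V W (\<lambda>y. f x y)) \<and>
     (\<forall>y\<in>V. linear_between V W (\<lambda>x. f x y))"

definition finite_dimensional :: "'a::real_vector set \<Rightarrow> bool" where
  "finite_dimensional V \<longleftrightarrow> subspace V \<and> (\<exists>S. finite S \<and> span S = V)"

definition lie_algebra_on :: "'a::real_vector set \<Rightarrow> ('a \<Rightarrow> 'a \<Rightarrow> 'a) \<Rightarrow> bool" where
  "lie_algebra_on V br \<longleftrightarrow>
     bilinear_between V V br \<and>
     (\<forall>x\<in>V. br x x = 0) \<and>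
     (\<forall>x\<in>V. \<forall>y\<in>V. \<forall>z\<in>V. br x (br y z) + br y (br z x) + br z (br x y) = 0)"

definition pseudo_euclidean_lie_algebra :: "'a::real_vector form_lie_algebra \<Rightarrow> bool" where
  "pseudo_euclidean_lie_algebra G \<longleftrightarrow>
     finite_dimensional (carrier G) \<and>
     lie_algebra_on (carrier G) (bracket G) \<and>
     bilinear_between (carrier G) UNIV (form G) \<and>
     (\<forall>u\<in>carrier G. \<forall>v\<in>carrier G. form G u v = form G v u) \<and>
     (\<forall>u\<in>carrier G. (\<forall>v\<in>carrier G. form G u v = 0) \<longrightarrow> u = 0)"

text \<open>By non-degeneracy of the form, the element described here exists and is unique.\<close>

definition levi_civita :: "'a::real_vector form_lie_algebra \<Rightarrow> 'a \<Rightarrow> 'a \<Rightarrow> 'a" where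
  "levi_civita G u v = (THE x. x \<in> carrier G \<and>
     (\<forall>w\<in>carrier G. 2 * form G x w =
        form G (bracket G u v) w + form G (bracket G w u) v + form G (bracket G w v) u))"

definition flat :: "'a::real_vector form_lie_algebra \<Rightarrow> bool" where
  "flat G \<longleftrightarrow> (\<forall>u\<in>carrier G. \<forall>v\<in>carrier G. \<forall>w\<in>carrier G.
     levi_civita G (levi_civita G u v) w - levi_civita G u (levi_civita G v w) =
     levi_civita G (levi_civita G v u) w - levi_civita G v (levi_civita G u w))"

text \<open>Signature \<open>(p, q)\<close>: an orthogonal basis with \<open>p\<close> negative and \<open>q\<close> positive vectors.\<close>

definition has_signature :: "'a::real_vector form_lie_algebra \<Rightarrow> nat \<Rightarrow> nat \<Rightarrow> bool" where
  "has_signature G p q \<longleftrightarrow> (\<exists>N P.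
     finite N \<and> finite P \<and> card N = p \<and> card P = q \<and> N \<inter> P = {} \<and>
     independent (N \<union> P) \<and> span (N \<union> P) = carrier G \<and>
     (\<forall>u\<in>N \<union> P. \<forall>v\<in>N \<union> P. u \<noteq> v \<longrightarrow> form G u v = 0) \<and>
     (\<forall>u\<in>N. form G u u < 0) \<and> (\<forall>u\<in>P. form G u u > 0))"

definition lorentzian :: "'a::real_vector form_lie_algebra \<Rightarrow> bool" where
  "lorentzian G \<longleftrightarrow> has_signature G 1 (dim (carrier G) - 1)"

primrec lower_central :: "'a::real_vector form_lie_algebra \<Rightarrow> nat \<Rightarrow> 'a set" where
  "lower_central G 0 = carrier G"
| "lower_central G (Suc k) =
     span {bracket G x y | x y. x \<in> carrier G \<and> y \<in> lower_central G k}"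

definition nilpotent_lie_algebra :: "'a::real_vector form_lie_algebra \<Rightarrow> bool" where
  "nilpotent_lie_algebra G \<longleftrightarrow> (\<exists>k. lower_central G k = {0})"

definition nilpotent_endo :: "'a::real_vector set \<Rightarrow> ('a \<Rightarrow> 'a) \<Rightarrow> bool" where
  "nilpotent_endo V f \<longleftrightarrow> (\<exists>k. \<forall>x\<in>V. (f ^^ k) x = 0)"

definition adjoint_endo :: "'a::real_vector form_lie_algebra \<Rightarrow> ('a \<Rightarrow> 'a) \<Rightarrow> 'a \<Rightarrow> 'a" where
  "adjoint_endo B f a =
     (THE x. x \<in> carrier B \<and> (\<forall>b\<in>carrier B. form B x b = form B a (f b)))"

definition admissible ::
  "'a::real_vector form_lie_algebra \<Rightarrow> ('a \<Rightarrow> 'a) \<Rightarrow> ('a \<Rightarrow> 'a) \<Rightarrow> real \<Rightarrow> 'a \<Rightarrow> bool" where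
  "admissible B \<xi> D \<mu> b0 \<longleftrightarrow>
     linear_between (carrier B) (carrier B) \<xi> \<and>
     linear_between (carrier B) (carrier B) D \<and>
     b0 \<in> carrier B \<and>
     (\<forall>a\<in>carrier B. \<forall>b\<in>carrier B.
        \<xi> (bracket B a b) = levi_civita B a (\<xi> b) - levi_civita B b (\<xi> a)) \<and>
     (\<forall>a\<in>carrier B. \<forall>b\<in>carrier B. form B (D a - \<xi> a) b = - form B a (D b - \<xi> b)) \<and>
     (\<forall>a\<in>carrier B. D (\<xi> a) - \<xi> (D a) = \<xi> (\<xi> a) - \<mu> *\<^sub>R \<xi> a - levi_civita B a b0) \<and>
     (\<forall>a\<in>carrier B. \<forall>b\<in>carrier B.
        levi_civita B a (\<xi> b) - \<xi> (levi_civita B a b) =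
        levi_civita B (D a) b + levi_civita B a (D b) - D (levi_civita B a b))"

text \<open>The triple \<open>(s, a, t)\<close> stands for \<open>s e + a + t \<bar>e\<close> in \<open>\<real>e \<oplus> B \<oplus> \<real>\<bar>e\<close>.\<close>

definition double_extension ::
  "'a::real_vector form_lie_algebra \<Rightarrow> ('a \<Rightarrow> 'a) \<Rightarrow> ('a \<Rightarrow> 'a) \<Rightarrow> real \<Rightarrow> 'a \<Rightarrow>
   (real \<times> 'a \<times> real) form_lie_algebra" where
  "double_extension B \<xi> D \<mu> b0 =
     \<lparr> carrier = UNIV \<times> carrier B \<times> UNIV,
       bracket = (\<lambda>(s, a, t) (s', a', t').
         (\<mu> * (t * s' - t' * s) - t * form B b0 a' + t' * form B b0 a
            + form B (\<xi> a - adjoint_endo B \<xi> a) a',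
          t *\<^sub>R D a' - t' *\<^sub>R D a + bracket B a a',
          0)),
       form = (\<lambda>(s, a, t) (s', a', t'). s * t' + t * s' + form B a a') \<rparr>"

definition isometrically_isomorphic ::
  "'a::real_vector form_lie_algebra \<Rightarrow> 'b::real_vector form_lie_algebra \<Rightarrow> bool" where
  "isometrically_isomorphic G H \<longleftrightarrow> (\<exists>\<phi>.
     linear_between (carrier G) (carrier H) \<phi> \<and>
     bij_betw \<phi> (carrier G) (carrier H) \<and>
     (\<forall>u\<in>carrier G. \<forall>v\<in>carrier G. \<phi> (bracket G u v) = bracket H (\<phi> u) (\<phi> v)) \<and>
     (\<forall>u\<in>carrier G. \<forall>v\<in>carrier G. form H (\<phi> u) (\<phi> v) = form G u v))"

end

theory Submission
  imports Defs
begin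

text \<open>
  Write \<open>u \<star> v\<close> for the Levi-Civita product, \<open>L\<^sub>u v = u \<star> v\<close>. The whole theorem rests on finding a
  null vector \<open>e \<noteq> 0\<close> with \<open>u \<star> e = e \<star> u = 0\<close> for every \<open>u\<close> (\<open>null_annihilator_exists\<close>).

  Given such an \<open>e\<close>, skewness of the \<open>L\<^sub>u\<close> puts every product into \<open>e\<^sup>\<bottom>\<close>, so \<open>\<real>e\<close> and
  \<open>e\<^sup>\<bottom>\<close> are two-sided ideals and \<open>e\<^sup>\<bottom> / \<real>e\<close> inherits a flat metric product. Choosing a null \<open>e'\<close> with
  \<open>\<langle>e, e'\<rangle> = 1\<close>, this quotient is realised on \<open>B = {e, e'}\<^sup>\<bottom>\<close>. The products that involve \<open>e'\<close> are recorded
  by \<open>\<xi> a = - a \<star> e'\<close>, \<open>D a = [e', a]\<close> and \<open>b\<^sub>0 = e' \<star> e'\<close>, all projected to \<open>B\<close>; the admissibility conditions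
  are left symmetry for triples containing \<open>e'\<close>. Here \<open>\<mu> = 0\<close> because \<open>e\<close> is central, \<open>D\<close> is nilpotent
  because it is induced by \<open>ad e'\<close>, and \<open>B\<close> is Lorentzian by the law of inertia, since a
  hyperbolic plane has been split off.

  To find \<open>e\<close>, the first point is that every \<open>L\<^sub>u\<close> is nilpotent (\<open>left_mult_nilpotent\<close>): the identity map
  is a cocycle with values in the module \<open>L\<close>, and on the Fitting-one component of \<open>L\<^sub>u\<close> it would be a
  coboundary \<open>v \<mapsto> v \<star> m\<close>; as \<open>v \<star> m\<close> is orthogonal to \<open>m\<close>, this forces \<open>m = 0\<close>.

  Let \<open>\<gg>'\<close> be the derived algebra of the algebra \<open>\<gg>\<close>. In the abelian case every null vector
  serves. If \<open>L\<^sub>x = 0\<close> for some nonzero \<open>x \<in> \<gg>'\<close>,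
  then such an \<open>x\<close> can be chosen central, and it is orthogonal to \<open>\<gg>'\<close>, in particular to itself.
  Otherwise a nonzero central \<open>c \<in> \<gg>'\<close> has \<open>L\<^sub>c \<noteq> 0\<close> and \<open>L\<^sub>c\<^sup>2 = 0\<close>, so the image \<open>W\<close> of \<open>L\<^sub>c\<close> is totally
  isotropic and, by the signature, a plane for which \<open>W\<^sup>\<bottom> / W\<close> is positive definite. All \<open>L\<^sub>u\<close> preserve \<open>W\<close>, and
  being nilpotent they kill a common \<open>e \<noteq> 0\<close> in \<open>W\<close> and map \<open>W\<^sup>\<bottom>\<close> into \<open>W\<close>. A skew map with
  image in a plane is determined up to a scalar, and comparing \<open>L\<^sub>e\<close> and its commutators with \<open>L\<^sub>c\<close> gives
  \<open>L\<^sub>e = 0\<close> (\<open>plane_meets_annihilator\<close>).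

  The structures of the theorem are meaningful only on a carrier. Composing them with a linear projection onto
  it makes them bilinear on the whole ambient space, and the algebraic identities then hold for all vectors.
\<close>

section \<open>Subspaces of finite dimension\<close>

lemma independent_card_le_finite_span:
  fixes I :: "'a::real_vector set"
  assumes "independent I" "I \<subseteq> span S" "finite S"
  shows "finite I \<and> card I \<le> card S"
  using real_vector.independent_span_bound[OF assms(3,1,2)] .

lemma finite_span_basis:
  fixes V :: "'a::real_vector set"
  assumes "subspace V" "V \<subseteq> span S" "finite S"
  obtains I where "finite I" "independent I" "I \<subseteq> V" "span I = V" "card I = dim V"
proof -
  obtain I where I: "I \<subseteq> V" "independent I" "V \<subseteq> span I"
    using maximal_independent_subset[of V] by blast
  have "span I = V"
    using I assms(1) by (simp add: span_minimal subset_antisym)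
  moreover have "finite I"
    using independent_card_le_finite_span[OF I(2) _ assms(3)] I(1) assms(2) by blast
  moreover have "card I = dim V"
    using I basis_card_eq_dim by blast
  ultimately show ?thesis using I that by blast
qed

lemma subspace_eq_if_dim_le:
  fixes U :: "'a::real_vector set"
  assumes "subspace U" "subspace V" "U \<subseteq> V" "V \<subseteq> span S" "finite S" "dim V \<le> dim U"
  shows "U = V"
proof (rule ccontr)
  assume "U \<noteq> V"
  then obtain x where x: "x \<in> V" "x \<notin> U" using assms by blast
  obtain I where I: "finite I" "independent I" "I \<subseteq> U" "span I = U" "card I = dim U"
    using finite_span_basis[OF assms(1) _ assms(5)] assms(3,4) by (metis subset_trans)
  obtain J where J: "finite J" "independent J" "J \<subseteq> V" "span J = V" "card J = dim V"
    using finite_span_basis[OF assms(2,4,5)] by metis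
  have "independent (insert x I)"
    using x I by (simp add: independent_insertI)
  moreover have "insert x I \<subseteq> span J"
    using x I J assms(3) by auto
  ultimately have "card (insert x I) \<le> card J"
    using independent_card_le_finite_span J(1) by blast
  moreover have "x \<notin> I" using x I by (metis span_base)
  ultimately show False using I J assms(6) by simp
qed

text \<open>
  The stable image is the Fitting-one component of \<open>T\<close>, on which \<open>T\<close> is onto.
\<close>

lemma powers_image_stabilizes:
  fixes T :: "'a::real_vector \<Rightarrow> 'a"
  assumes T: "linear T" and V: "subspace V" "V = span S" "finite S" and inv: "T ` V \<subseteq> V"
  obtains N where "\<And>k. (T ^^ (N + k)) ` V = (T ^^ N) ` V"
proof -
  have sub: "subspace ((T ^^ k) ` V)" for k
  proof -
    have "linear (T ^^ k)"
      by (induction k) (use linear_id linear_compose[OF _ T] in \<open>simp_all add: id_def o_def\<close>)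
    then show ?thesis using V(1) linear_subspace_image by blast
  qed
  have dec: "(T ^^ Suc k) ` V \<subseteq> (T ^^ k) ` V" for k
  proof -
    have "(T ^^ Suc k) ` V = (T ^^ k) ` (T ` V)"
      by (simp only: funpow_Suc_right image_comp)
    then show ?thesis using inv by (metis image_mono)
  qed
  have inV: "(T ^^ k) ` V \<subseteq> V" for k
    by (induction k) (use dec in \<open>simp, blast\<close>)
  \<comment> \<open>A power whose image has the least possible dimension works.\<close>
  define d where "d k = dim ((T ^^ k) ` V)" for k
  obtain N where N: "\<And>k. d N \<le> d k"
    using ex_has_least_nat[of "\<lambda>_. True" 0 d] by auto
  have stable: "(T ^^ Suc N) ` V = (T ^^ N) ` V"
    using subspace_eq_if_dim_le[OF sub sub dec _ V(3)] inV V(2) N[of "Suc N"]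
    unfolding d_def by blast
  have "(T ^^ (N + k)) ` V = (T ^^ N) ` V" for k
  proof (induction k)
    case (Suc k)
    have "(T ^^ (N + Suc k)) ` V = T ` ((T ^^ (N + k)) ` V)"
      by (simp add: image_comp)
    also have "\<dots> = (T ^^ Suc N) ` V"
      using Suc by (simp add: image_comp)
    finally show ?case using stable by simp
  qed simp
  then show ?thesis using that by blast
qed

section \<open>Orthogonal bases and signature\<close>

locale symmetric_form =
  fixes F :: "'a::real_vector \<Rightarrow> 'a \<Rightarrow> real" (\<open>\<langle>_, _\<rangle>\<close>)
  assumes form_bilinear: "bilinear F" and form_sym: "\<langle>x, y\<rangle> = \<langle>y, x\<rangle>"
begin

lemma form_linear_left: "linear (\<lambda>x. \<langle>x, y\<rangle>)" and form_linear_right: "linear (F x)"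
  using form_bilinear by (auto simp: bilinear_def)

lemmas form_simps [simp] =
  bilinear_ladd[OF form_bilinear] bilinear_radd[OF form_bilinear]
  bilinear_lsub[OF form_bilinear] bilinear_rsub[OF form_bilinear]
  bilinear_lneg[OF form_bilinear] bilinear_rneg[OF form_bilinear]
  bilinear_lzero[OF form_bilinear] bilinear_rzero[OF form_bilinear]
  bilinear_lmul[OF form_bilinear] bilinear_rmul[OF form_bilinear]

lemmas form_sum_left = linear_sum[OF form_linear_left]
lemmas form_sum_right = linear_sum[OF form_linear_right]

definition nondegenerate_on :: "'a set \<Rightarrow> bool" where
  "nondegenerate_on V \<longleftrightarrow> (\<forall>x\<in>V. (\<forall>y\<in>V. \<langle>x, y\<rangle> = 0) \<longrightarrow> x = 0)"

definition orthogonal_family :: "'a set \<Rightarrow> bool" where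
  "orthogonal_family E \<longleftrightarrow> finite E \<and> (\<forall>u\<in>E. \<forall>v\<in>E. u \<noteq> v \<longrightarrow> \<langle>u, v\<rangle> = 0) \<and>
     (\<forall>u\<in>E. \<langle>u, u\<rangle> \<noteq> 0)"

text \<open>
  For an orthogonal family \<open>E\<close> this is the orthogonal projection onto \<open>span E\<close>. For any \<open>E\<close> it is a
  linear map of the whole space.
\<close>

definition projection :: "'a set \<Rightarrow> 'a \<Rightarrow> 'a" where
  "projection E x = (\<Sum>u\<in>E. (\<langle>x, u\<rangle> / \<langle>u, u\<rangle>) *\<^sub>R u)"

lemma projection_in_span: "projection E x \<in> span E"
  unfolding projection_def by (intro span_sum span_scale span_base)

lemma linear_projection: "linear (projection E)"
  by (rule linearI)
    (auto simp: projection_def add_divide_distrib scaleR_add_left sum.distrib scaleR_sum_right)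

lemma projection_pairing:
  assumes "orthogonal_family E" "u \<in> E"
  shows "\<langle>projection E x, u\<rangle> = \<langle>x, u\<rangle>"
proof -
  have "\<langle>projection E x, u\<rangle> = (\<Sum>v\<in>E. (\<langle>x, v\<rangle> / \<langle>v, v\<rangle>) * \<langle>v, u\<rangle>)"
    unfolding projection_def form_sum_left by simp
  also have "\<dots> = (\<Sum>v\<in>E. if v = u then \<langle>x, u\<rangle> else 0)"
    using assms by (intro sum.cong) (auto simp: orthogonal_family_def)
  finally show ?thesis using assms by (simp add: orthogonal_family_def)
qed

lemma projection_of_member:
  assumes "orthogonal_family E" "u \<in> E"
  shows "projection E u = u"
proof -
  have "projection E u = (\<Sum>v\<in>E. if v = u then u else 0)"
    unfolding projection_def
    using assms by (intro sum.cong) (auto simp: orthogonal_family_def)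
  then show ?thesis using assms by (simp add: orthogonal_family_def)
qed

lemma projection_id:
  assumes "orthogonal_family E" "x \<in> span E"
  shows "projection E x = x"
proof -
  have "linear (\<lambda>x. x :: 'a)" by (simp add: linear_iff)
  from linear_eq_on_span[OF linear_projection this _ assms(2)] show ?thesis
    using projection_of_member[OF assms(1)] by simp
qed

lemma orthogonal_independent:
  assumes "orthogonal_family E"
  shows "independent E"
proof (rule independent_if_scalars_zero)
  show "finite E" using assms by (simp add: orthogonal_family_def)
next
  fix c u assume c: "(\<Sum>x\<in>E. c x *\<^sub>R x) = 0" and u: "u \<in> E"
  have "0 = \<langle>\<Sum>x\<in>E. c x *\<^sub>R x, u\<rangle>" using c by simp
  also have "\<dots> = (\<Sum>x\<in>E. c x * \<langle>x, u\<rangle>)"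
    unfolding form_sum_left by simp
  also have "\<dots> = (\<Sum>x\<in>E. if x = u then c u * \<langle>u, u\<rangle> else 0)"
    using assms u by (intro sum.cong) (auto simp: orthogonal_family_def)
  also have "\<dots> = c u * \<langle>u, u\<rangle>" using assms u by (simp add: orthogonal_family_def)
  finally show "c u = 0" using assms u by (auto simp: orthogonal_family_def)
qed

text \<open>
  An orthogonal family of non-null vectors in \<open>V\<close> is independent, so there is one of maximal size. If it did not
  span \<open>V\<close>, its orthogonal complement would be isotropic by maximality, hence by polarization and
  nondegeneracy zero.
\<close>

lemma orthogonal_basis_exists:
  assumes V: "subspace V" "V = span S" "finite S" and nondeg: "nondegenerate_on V"
  obtains E where "orthogonal_family E" "span E = V"
proof -
  define Q where "Q E \<longleftrightarrow> orthogonal_family E \<and> E \<subseteq> V" for E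
  have "Q {}" by (simp add: Q_def orthogonal_family_def)
  moreover have "card E < Suc (card S)" if "Q E" for E
    using independent_card_le_finite_span[of E S] orthogonal_independent that V
    by (auto simp: Q_def)
  ultimately obtain E where E: "Q E" "\<And>E'. Q E' \<Longrightarrow> card E' \<le> card E"
    using ex_has_greatest_nat[of Q "{}" card "Suc (card S)"] by auto
  have ortho: "orthogonal_family E" and EV: "E \<subseteq> V" using E by (auto simp: Q_def)
  have spanE: "span E \<subseteq> V" using EV V(1) by (simp add: span_minimal)
  define r where "r x = x - projection E x" for x
  have rV: "r x \<in> V" if "x \<in> V" for x
    unfolding r_def using that V(1) spanE projection_in_span subspace_diff by blast
  have r_orth: "\<langle>r x, u\<rangle> = 0" if "u \<in> E" for x u
    using projection_pairing[OF ortho that] by (simp add: r_def)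
  have isotropic: "\<langle>y, y\<rangle> = 0" if y: "y \<in> V" "\<And>u. u \<in> E \<Longrightarrow> \<langle>y, u\<rangle> = 0" for y
  proof (rule ccontr)
    assume "\<langle>y, y\<rangle> \<noteq> 0"
    then have new: "y \<notin> E" using y by auto
    have "Q (insert y E)"
      unfolding Q_def orthogonal_family_def
      using ortho EV y \<open>\<langle>y, y\<rangle> \<noteq> 0\<close> form_sym by (auto simp: orthogonal_family_def)
    then have "card (insert y E) \<le> card E" by (rule E(2))
    then show False using new ortho by (simp add: orthogonal_family_def)
  qed
  have "x \<in> span E" if x: "x \<in> V" for x
  proof -
    have "\<langle>r x, z\<rangle> = 0" if z: "z \<in> V" for z
    proof -
      \<comment> \<open>polarization of the isotropic complement of \<open>E\<close>\<close>
      have "\<langle>r x + r z, r x + r z\<rangle> = 0"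
        by (rule isotropic) (use x z V(1) rV r_orth in \<open>auto intro: subspace_add\<close>)
      moreover have "\<langle>r x, r x\<rangle> = 0" "\<langle>r z, r z\<rangle> = 0"
        by (rule isotropic; use x z rV r_orth in auto)+
      ultimately have "\<langle>r x, r z\<rangle> = 0"
        by (simp add: form_sym[of "r z" "r x"])
      moreover have "\<langle>r x, projection E z\<rangle> = 0"
        unfolding projection_def form_sum_right using r_orth by simp
      ultimately show ?thesis by (simp add: r_def[of z])
    qed
    then have "r x = 0" using nondeg rV[OF x] by (auto simp: nondegenerate_on_def)
    then show ?thesis using projection_in_span[of E x] by (simp add: r_def)
  qed
  then show ?thesis using that[OF ortho] spanE by blast
qed

lemma represent_functional:
  assumes "subspace V" "V = span S" "finite S" "nondegenerate_on V" and "linear f"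
  obtains x where "x \<in> V" "\<And>y. y \<in> V \<Longrightarrow> \<langle>x, y\<rangle> = f y"
proof -
  obtain E where E: "orthogonal_family E" "span E = V"
    using orthogonal_basis_exists[OF assms(1-4)] by metis
  define x where "x = (\<Sum>u\<in>E. (f u / \<langle>u, u\<rangle>) *\<^sub>R u)"
  have "\<langle>x, u\<rangle> = f u" if u: "u \<in> E" for u
  proof -
    have "\<langle>x, u\<rangle> = (\<Sum>v\<in>E. (f v / \<langle>v, v\<rangle>) * \<langle>v, u\<rangle>)"
      unfolding x_def form_sum_left by simp
    also have "\<dots> = (\<Sum>v\<in>E. if v = u then f u else 0)"
      using E u by (intro sum.cong) (auto simp: orthogonal_family_def)
    finally show ?thesis using E u by (simp add: orthogonal_family_def)
  qed
  then have "\<langle>x, y\<rangle> = f y" if "y \<in> V" for y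
    using linear_eq_on_span[OF form_linear_right assms(5), of E x y] E(2) that by blast
  moreover have "x \<in> V"
    unfolding x_def E(2)[symmetric] by (intro span_sum span_scale span_base)
  ultimately show ?thesis using that by blast
qed

definition signature_basis :: "'a set \<Rightarrow> 'a set \<Rightarrow> 'a set \<Rightarrow> bool" where
  "signature_basis V N P \<longleftrightarrow> orthogonal_family (N \<union> P) \<and> span (N \<union> P) = V \<and>
     (\<forall>u\<in>N. \<langle>u, u\<rangle> < 0) \<and> (\<forall>u\<in>P. \<langle>u, u\<rangle> > 0)"

lemma signature_basis_exists:
  assumes "subspace V" "V = span S" "finite S" "nondegenerate_on V"
  obtains N P where "signature_basis V N P"
proof -
  obtain E where E: "orthogonal_family E" "span E = V"
    using orthogonal_basis_exists[OF assms] by metis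
  let ?N = "{u \<in> E. \<langle>u, u\<rangle> < 0}" and ?P = "{u \<in> E. \<langle>u, u\<rangle> > 0}"
  have "?N \<union> ?P = E" using E by (force simp: orthogonal_family_def)
  then have "signature_basis V ?N ?P" using E by (simp add: signature_basis_def)
  then show ?thesis using that by blast
qed

lemma span_orthogonal_nonneg:
  assumes "orthogonal_family P" "\<forall>u\<in>P. \<langle>u, u\<rangle> > 0" "x \<in> span P" "\<langle>x, x\<rangle> \<le> 0"
  shows "x = 0"
proof -
  have x: "x = projection P x" using assms(1,3) projection_id by simp
  have fin: "finite P" using assms(1) by (simp add: orthogonal_family_def)
  have "\<langle>x, x\<rangle> = (\<Sum>u\<in>P. (\<langle>x, u\<rangle> / \<langle>u, u\<rangle>) * \<langle>x, u\<rangle>)"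
    by (subst (2) x) (simp add: projection_def form_sum_right)
  then have "(\<Sum>u\<in>P. \<langle>x, u\<rangle>\<^sup>2 / \<langle>u, u\<rangle>) \<le> 0" using assms(4) by (simp add: power2_eq_square)
  moreover have nonneg: "\<forall>u\<in>P. 0 \<le> \<langle>x, u\<rangle>\<^sup>2 / \<langle>u, u\<rangle>" using assms(2) by (simp add: less_imp_le)
  ultimately have "\<forall>u\<in>P. \<langle>x, u\<rangle>\<^sup>2 / \<langle>u, u\<rangle> = 0"
    using sum_nonneg_eq_0_iff[OF fin] sum_nonneg[of P] by (metis (no_types, lifting) antisym)
  then have "\<forall>u\<in>P. \<langle>x, u\<rangle> = 0" using assms(2) by fastforce
  then show ?thesis by (subst x) (simp add: projection_def)
qed

text \<open>
  Projection to the negative part \<open>span N\<close> is injective on a negative semidefinite subspace: its kernel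
  in \<open>V\<close> is the positive definite \<open>span P\<close>. This bound gives both the law of inertia and the
  maximality of isotropic planes.
\<close>

lemma negative_semidefinite_card_le:
  assumes sb: "signature_basis V N P" and I: "independent I" "span I \<subseteq> V"
    and neg: "\<And>x. x \<in> span I \<Longrightarrow> \<langle>x, x\<rangle> \<le> 0"
  shows "card I \<le> card N"
proof -
  have NP: "orthogonal_family (N \<union> P)" and V: "span (N \<union> P) = V"
    and P: "\<forall>u\<in>P. \<langle>u, u\<rangle> > 0" and N: "\<forall>u\<in>N. \<langle>u, u\<rangle> < 0"
    using sb by (auto simp: signature_basis_def)
  have oN: "orthogonal_family N" and oP: "orthogonal_family P"
    using NP by (auto simp: orthogonal_family_def)
  have disj: "N \<inter> P = {}" using N P by force
  have "finite N" "finite P" using oN oP by (auto simp: orthogonal_family_def)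
  then have split: "projection (N \<union> P) x = projection N x + projection P x" for x
    unfolding projection_def using disj by (simp add: sum.union_disjoint)
  have ker: "x = 0" if x: "x \<in> span I" "projection N x = 0" for x
  proof -
    have "x \<in> span (N \<union> P)" using x I(2) V by auto
    then have "x = projection P x" using split[of x] x projection_id[OF NP] by simp
    then have "x \<in> span P" using projection_in_span[of P x] by simp
    then show ?thesis using span_orthogonal_nonneg[OF oP P] neg x by simp
  qed
  have inj: "inj_on (projection N) (span I)"
  proof (rule inj_onI)
    fix x y assume "x \<in> span I" "y \<in> span I" "projection N x = projection N y"
    then have "x - y = 0"
      by (intro ker[OF span_diff]) (simp_all add: linear_diff[OF linear_projection])
    then show "x = y" by simp
  qed
  have "independent (projection N ` I)"
    using linear_independent_injective_image[OF linear_projection I(1) inj] .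
  moreover have "projection N ` I \<subseteq> span N" using projection_in_span by blast
  ultimately have "card (projection N ` I) \<le> card N"
    using independent_card_le_finite_span \<open>finite N\<close> by blast
  moreover have "inj_on (projection N) I" using inj span_superset inj_on_subset by blast
  ultimately show ?thesis by (simp add: card_image)
qed

text \<open>
  With only two negative directions, adjoining to the isotropic plane \<open>span {a, b}\<close> an orthogonal
  non-positive vector \<open>x\<close> yields a negative semidefinite space, which has dimension at most two. The vectors \<open>q\<close>
  and \<open>- p\<close> are dual to \<open>a\<close> and \<open>b\<close> and read off the coordinates of \<open>x\<close>.
\<close>

lemma isotropic_plane_maximal:
  assumes subspace_V: "subspace V"
    and sb: "signature_basis V N P" "card N = 2"
    and a: "a \<in> V" "\<langle>a, a\<rangle> = 0" "\<langle>a, b\<rangle> = 0" "\<langle>a, p\<rangle> = 0" "\<langle>a, q\<rangle> = 1"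
    and b: "b \<in> V" "\<langle>b, b\<rangle> = 0" "\<langle>b, p\<rangle> = - 1" "\<langle>b, q\<rangle> = 0"
    and x: "x \<in> V" "\<langle>x, a\<rangle> = 0" "\<langle>x, b\<rangle> = 0" "\<langle>x, x\<rangle> \<le> 0"
  shows "x = \<langle>x, q\<rangle> *\<^sub>R a - \<langle>x, p\<rangle> *\<^sub>R b"
proof -
  have spans: "span {a, b} = {s *\<^sub>R a + t *\<^sub>R b | s t. True}"
    by (auto simp: span_insert span_singleton algebra_simps)
  have "x \<in> span {a, b}"
  proof (rule ccontr)
    assume nx: "x \<notin> span {a, b}"
    have "b \<noteq> 0" using b by auto
    moreover have "a \<notin> span {b}" using a b by (auto simp: span_singleton)
    ultimately have "independent {a, b}" by (simp add: independent_insertI dependent_single)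
    then have ind: "independent {x, a, b}" using nx by (rule independent_insertI[rotated])
    have "a \<noteq> b" using a b by auto
    moreover have "x \<noteq> a" "x \<noteq> b" using nx by (auto simp: span_base)
    ultimately have "card {x, a, b} = 3" by simp
    moreover have "card {x, a, b} \<le> card N"
    proof (rule negative_semidefinite_card_le[OF sb(1) ind])
      show "span {x, a, b} \<subseteq> V" using a b x subspace_V by (intro span_minimal) auto
      fix y assume "y \<in> span {x, a, b}"
      then obtain k where "y - k *\<^sub>R x \<in> span {a, b}" by (auto simp: span_insert)
      then obtain s t where "y - k *\<^sub>R x = s *\<^sub>R a + t *\<^sub>R b" using spans by auto
      then have y: "y = k *\<^sub>R x + s *\<^sub>R a + t *\<^sub>R b" by (simp add: algebra_simps)
      have "\<langle>y, y\<rangle> = k * k * \<langle>x, x\<rangle>"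
        using a b x form_sym[of a x] form_sym[of b x] form_sym[of b a] by (simp add: y)
      then show "\<langle>y, y\<rangle> \<le> 0" using x by (simp add: mult_nonneg_nonpos)
    qed
    ultimately show False using sb by simp
  qed
  then obtain s t where xs: "x = s *\<^sub>R a + t *\<^sub>R b" using spans by auto
  then have "\<langle>x, q\<rangle> = s" "\<langle>x, p\<rangle> = - t" using a b by simp_all
  then show ?thesis using xs by simp
qed

lemma negative_on_span:
  assumes "orthogonal_family N" "\<forall>u\<in>N. \<langle>u, u\<rangle> < 0" "x \<in> span N"
  shows "\<langle>x, x\<rangle> \<le> 0"
proof -
  have x: "x = projection N x" using assms projection_id by simp
  have "\<langle>x, x\<rangle> = (\<Sum>u\<in>N. (\<langle>x, u\<rangle> / \<langle>u, u\<rangle>) * \<langle>x, u\<rangle>)"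
    by (subst (2) x) (simp add: projection_def form_sum_right)
  also have "\<dots> \<le> 0"
    using assms(2)
    by (intro sum_nonpos) (auto simp: divide_nonneg_neg less_imp_le)
  finally show ?thesis .
qed

lemma inertia:
  assumes "signature_basis V N P" "signature_basis V N' P'"
  shows "card N = card N'"
proof -
  have le: "card N \<le> card N'" if s: "signature_basis V N P" "signature_basis V N' P'" for N P N' P'
  proof (rule negative_semidefinite_card_le[OF s(2)])
    have "orthogonal_family N" "\<forall>u\<in>N. \<langle>u, u\<rangle> < 0"
      using s(1) by (auto simp: signature_basis_def orthogonal_family_def)
    then show "independent N" "\<And>x. x \<in> span N \<Longrightarrow> \<langle>x, x\<rangle> \<le> 0"
      using orthogonal_independent negative_on_span by auto
    show "span N \<subseteq> V" using s(1) span_mono[of N "N \<union> P"] by (auto simp: signature_basis_def)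
  qed
  then show ?thesis using assms by (meson le_antisym)
qed

end

section \<open>Flat metric products\<close>

text \<open>
  The Levi-Civita product of a flat metric Lie algebra, which determines its bracket as the commutator. The
  identities are required for all vectors of the ambient space, so that they can be used as rewrite rules; only
  nondegeneracy is confined to \<open>V\<close>.
\<close>

locale flat_metric_algebra = symmetric_form F
  for F :: "'a::real_vector \<Rightarrow> 'a \<Rightarrow> real" (\<open>\<langle>_, _\<rangle>\<close>) +
  fixes V :: "'a set" and mult :: "'a \<Rightarrow> 'a \<Rightarrow> 'a" (infixl \<open>\<star>\<close> 70)
  assumes subspace_V: "subspace V"
    and finite_span: "\<exists>S. finite S \<and> span S = V"
    and nondegenerate: "nondegenerate_on V"
    and mult_bilinear: "bilinear (\<star>)"
    and mult_closed [simp]: "u \<star> v \<in> V"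
    and mult_skew: "\<langle>u \<star> v, w\<rangle> = - \<langle>v, u \<star> w\<rangle>"
    and left_symmetric: "(u \<star> v) \<star> w - u \<star> (v \<star> w) = (v \<star> u) \<star> w - v \<star> (u \<star> w)"
begin

lemmas mult_simps [simp] =
  bilinear_ladd[OF mult_bilinear] bilinear_radd[OF mult_bilinear]
  bilinear_lsub[OF mult_bilinear] bilinear_rsub[OF mult_bilinear]
  bilinear_lneg[OF mult_bilinear] bilinear_rneg[OF mult_bilinear]
  bilinear_lzero[OF mult_bilinear] bilinear_rzero[OF mult_bilinear]
  bilinear_lmul[OF mult_bilinear] bilinear_rmul[OF mult_bilinear]

lemma mult_linear: "linear ((\<star>) u)"
  using mult_bilinear by (simp add: bilinear_def)

lemma V_closed [simp]:
  "0 \<in> V" "x \<in> V \<Longrightarrow> y \<in> V \<Longrightarrow> x + y \<in> V" "x \<in> V \<Longrightarrow> y \<in> V \<Longrightarrow> x - y \<in> V"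
  "x \<in> V \<Longrightarrow> r *\<^sub>R x \<in> V" "x \<in> V \<Longrightarrow> - x \<in> V"
  using subspace_V
  by (auto simp: subspace_0 subspace_add subspace_diff subspace_scale subspace_neg)

lemma eq_zeroI: "x \<in> V \<Longrightarrow> (\<And>y. y \<in> V \<Longrightarrow> \<langle>x, y\<rangle> = 0) \<Longrightarrow> x = 0"
  using nondegenerate by (auto simp: nondegenerate_on_def)

lemma mult_self_pairing: "\<langle>u \<star> v, v\<rangle> = 0"
  using mult_skew[of u v v] form_sym[of v "u \<star> v"] by simp

definition com :: "'a \<Rightarrow> 'a \<Rightarrow> 'a" where
  "com u v = u \<star> v - v \<star> u"

abbreviation alg :: "'a form_lie_algebra" where
  "alg \<equiv> \<lparr>carrier = V, bracket = com, form = F\<rparr>"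

lemma com_closed [simp]: "com u v \<in> V"
  by (simp add: com_def)

lemma com_zero [simp]: "com u 0 = 0" "com 0 u = 0" "com u u = 0"
  by (simp_all add: com_def)

lemma com_anti: "com u v = - com v u"
  by (simp add: com_def)

text \<open>
  Flatness: left multiplication is a representation of the Lie algebra.
\<close>

lemma com_mult: "com u v \<star> w = u \<star> (v \<star> w) - v \<star> (u \<star> w)"
  using left_symmetric[of u v w] by (simp add: com_def algebra_simps)

lemma com_bilinear: "bilinear com"
  unfolding bilinear_def by (auto intro!: linearI simp: com_def algebra_simps)

lemmas com_linear_simps =
  bilinear_ladd[OF com_bilinear] bilinear_radd[OF com_bilinear]
  bilinear_lsub[OF com_bilinear] bilinear_rsub[OF com_bilinear]
  bilinear_lneg[OF com_bilinear] bilinear_rneg[OF com_bilinear]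
  bilinear_lmul[OF com_bilinear] bilinear_rmul[OF com_bilinear]

lemma com_jacobi: "com x (com y z) + com y (com z x) + com z (com x y) = 0"
proof -
  have expand: "com x (com y z) = x \<star> (y \<star> z) - x \<star> (z \<star> y) - (y \<star> (z \<star> x) - z \<star> (y \<star> x))" for x y z
    by (subst com_def, subst com_mult) (simp add: com_def)
  show ?thesis
    unfolding expand[of x y z] expand[of y z x] expand[of z x y] by simp
qed

lemma koszul: "2 * \<langle>u \<star> v, w\<rangle> = \<langle>com u v, w\<rangle> + \<langle>com w u, v\<rangle> + \<langle>com w v, u\<rangle>"
  using mult_skew[of u v w] mult_skew[of v u w] mult_skew[of w u v]
    form_sym[of v "u \<star> w"] form_sym[of u "v \<star> w"] form_sym[of u "w \<star> v"]
  by (simp add: com_def)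

lemma central_square:
  assumes "c \<in> V" "\<And>u. u \<in> V \<Longrightarrow> com u c = 0"
  shows "c \<star> c = 0"
proof (rule eq_zeroI)
  fix w assume "w \<in> V"
  then show "\<langle>c \<star> c, w\<rangle> = 0" using koszul[of c c w] assms by simp
qed simp

abbreviation lc :: "nat \<Rightarrow> 'a set" where
  "lc \<equiv> lower_central alg"

lemma subspace_lc: "subspace (lc k)"
  using subspace_V by (cases k) (auto simp: subspace_span)

lemma lc_subset: "lc k \<subseteq> V"
proof (cases k)
  case (Suc j)
  have "{com x y |x y. x \<in> V \<and> y \<in> lc j} \<subseteq> V" by auto
  then show ?thesis using Suc subspace_V by (simp add: span_minimal)
qed simp

lemma com_lc: "u \<in> V \<Longrightarrow> x \<in> lc k \<Longrightarrow> com u x \<in> lc (Suc k)"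
  by (simp, rule span_base, blast)

text \<open>
  The Fitting-null component of left multiplication by \<open>u\<close>.
\<close>

definition null_component :: "'a \<Rightarrow> 'a set" where
  "null_component u = {y \<in> V. \<exists>k. ((\<star>) u ^^ k) y = 0}"

lemma power_linear: "linear ((\<star>) u ^^ k)"
  by (induction k) (use linear_id linear_compose[OF _ mult_linear] in \<open>simp_all add: id_def o_def\<close>)

lemma power_zero_mono:
  assumes "((\<star>) u ^^ k) y = 0" "k \<le> j"
  shows "((\<star>) u ^^ j) y = 0"
  using assms(2,1) by (induction rule: dec_induct) auto

lemma null_component_zero: "0 \<in> null_component u"
  by (auto simp: null_component_def intro!: exI[of _ "0::nat"])

lemma null_component_add:
  assumes "x \<in> null_component u" "y \<in> null_component u"
  shows "x + y \<in> null_component u"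
proof -
  obtain j k where "((\<star>) u ^^ j) x = 0" "((\<star>) u ^^ k) y = 0"
    using assms by (auto simp: null_component_def)
  then have "((\<star>) u ^^ (max j k)) (x + y) = 0"
    using power_zero_mono[of j u x "max j k"] power_zero_mono[of k u y "max j k"]
    by (simp add: linear_add[OF power_linear])
  then show ?thesis using assms by (auto simp: null_component_def)
qed

lemma null_component_lift:
  assumes "y \<in> V" "u \<star> y \<in> null_component u"
  shows "y \<in> null_component u"
proof -
  obtain k where "((\<star>) u ^^ k) (u \<star> y) = 0" using assms by (auto simp: null_component_def)
  then have "((\<star>) u ^^ Suc k) y = 0" by (simp only: funpow_Suc_right o_def)
  then show ?thesis using assms unfolding null_component_def by blast
qed

text \<open>
  Left multiplications by ad-nilpotent elements preserve the Fitting-null component, by a double induction on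
  \<open>u \<star> (w \<star> y) = w \<star> (u \<star> y) + [u, w] \<star> y\<close>.
\<close>

lemma null_component_mult:
  assumes "w \<in> V" "(com u ^^ j) w = 0" "y \<in> null_component u"
  shows "w \<star> y \<in> null_component u"
  using assms
proof (induction j arbitrary: w y)
  case 0
  then show ?case by (simp add: null_component_zero)
next
  case (Suc j)
  obtain k where "((\<star>) u ^^ k) y = 0" using Suc by (auto simp: null_component_def)
  then show ?case using Suc.prems(3)
  proof (induction k arbitrary: y)
    case 0
    then show ?case by (simp add: null_component_zero)
  next
    case (Suc k)
    have "(\<star>) u ^^ Suc k = ((\<star>) u ^^ k) \<circ> (\<star>) u" by (rule funpow_Suc_right)
    then have uy: "((\<star>) u ^^ k) (u \<star> y) = 0" using Suc.prems(1) by simp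
    then have "u \<star> y \<in> null_component u" by (auto simp: null_component_def)
    then have "w \<star> (u \<star> y) \<in> null_component u" using Suc.IH uy by blast
    moreover have "com u w \<star> y \<in> null_component u"
      using Suc.prems(2) \<open>(com u ^^ Suc j) w = 0\<close>
      by (intro \<open>\<And>w y. w \<in> V \<Longrightarrow> (com u ^^ j) w = 0 \<Longrightarrow> y \<in> null_component u \<Longrightarrow> w \<star> y \<in> null_component u\<close>)
        (simp_all only: com_closed funpow_Suc_right o_def)
    moreover have "u \<star> (w \<star> y) = w \<star> (u \<star> y) + com u w \<star> y"
      by (simp add: com_mult)
    ultimately show ?case
      using null_component_add null_component_lift mult_closed by metis
  qed
qed

end

section \<open>Nilpotency of left multiplications\<close>

locale nilpotent_flat_algebra = flat_metric_algebra F V mult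
  for F :: "'a::real_vector \<Rightarrow> 'a \<Rightarrow> real" (\<open>\<langle>_, _\<rangle>\<close>)
    and V and mult (infixl \<open>\<star>\<close> 70) +
  assumes nilpotent: "nilpotent_lie_algebra alg"
begin

lemma ad_nilpotent:
  assumes "u \<in> V"
  obtains k where "\<And>w. w \<in> V \<Longrightarrow> (com u ^^ k) w = 0"
proof -
  obtain k where k: "lc k = {0}" using nilpotent by (auto simp: nilpotent_lie_algebra_def)
  have "(com u ^^ j) w \<in> lc j" if "w \<in> V" for j w
    using that by (induction j) (use com_lc[OF assms] in auto)
  then show ?thesis using that[of k] k by blast
qed

lemma ad_eigenvalue_zero:
  assumes "u \<in> V" "x \<in> V" "x \<noteq> 0" "com u x = r *\<^sub>R x"
  shows "r = 0"
proof -
  obtain k where "(com u ^^ k) x = 0" using ad_nilpotent assms by metis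
  moreover have "(com u ^^ j) x = r ^ j *\<^sub>R x" for j
    by (induction j) (simp_all add: com_linear_simps assms(4))
  ultimately show ?thesis using assms(3) by simp
qed

text \<open>
  A nonzero ideal meets the centre: as long as an element of it is not central, some bracket is a nonzero element
  further down the lower central series, which ends in zero.
\<close>

lemma central_element_exists:
  assumes J: "x \<in> J" "x \<noteq> 0" "J \<subseteq> V" "\<And>u y. u \<in> V \<Longrightarrow> y \<in> J \<Longrightarrow> com u y \<in> J"
  obtains z where "z \<in> J" "z \<noteq> 0" "\<And>u. u \<in> V \<Longrightarrow> com u z = 0"
proof (rule ccontr)
  assume no: "\<not> thesis"
  have "\<exists>y \<in> J. y \<noteq> 0 \<and> y \<in> lc k" for k
  proof (induction k)
    case 0
    then show ?case using J by auto
  next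
    case (Suc k)
    then obtain y where y: "y \<in> J" "y \<noteq> 0" "y \<in> lc k" by blast
    moreover have "\<exists>u\<in>V. com u y \<noteq> 0" using no that y by blast
    ultimately obtain u where "u \<in> V" "com u y \<noteq> 0" by blast
    then show ?case using y J(4) com_lc by blast
  qed
  then show False using nilpotent by (auto simp: nilpotent_lie_algebra_def)
qed

text \<open>
  Pick \<open>m\<close> in the stable image of \<open>L\<^sub>u\<close> such that \<open>u - u \<star> m\<close> lies in the Fitting-null component. The cocycle
  \<open>c v = v - v \<star> m\<close> satisfies \<open>u \<star> c v = c [u, v] + v \<star> c u\<close>, so nilpotency of \<open>ad u\<close> puts all of its values into
  the Fitting-null component, which is orthogonal to the stable image. Hence
  \<open>\<langle>v, m\<rangle> = \<langle>c v, m\<rangle> + \<langle>v \<star> m, m\<rangle> = 0\<close> for all \<open>v\<close>, that is \<open>m = 0\<close>, and \<open>c\<close> is the identity.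
\<close>

theorem left_mult_nilpotent:
  assumes u: "u \<in> V" and w: "w \<in> V"
  shows "\<exists>k. ((\<star>) u ^^ k) w = 0"
proof -
  obtain S where S: "finite S" "V = span S" using finite_span by auto
  have "(\<star>) u ` V \<subseteq> V" by auto
  from powers_image_stabilizes[OF mult_linear subspace_V S(2,1) this]
  obtain N where N: "\<And>k. ((\<star>) u ^^ (N + k)) ` V = ((\<star>) u ^^ N) ` V" by metis
  have skew_power: "\<langle>((\<star>) u ^^ k) x, y\<rangle> = (- 1) ^ k * \<langle>x, ((\<star>) u ^^ k) y\<rangle>" for k x y
  proof (induction k arbitrary: y)
    case (Suc k)
    have "\<langle>((\<star>) u ^^ Suc k) x, y\<rangle> = - \<langle>((\<star>) u ^^ k) x, u \<star> y\<rangle>" by (simp add: mult_skew)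
    also have "\<dots> = - ((- 1) ^ k * \<langle>x, ((\<star>) u ^^ k) (u \<star> y)\<rangle>)" using Suc by simp
    also have "((\<star>) u ^^ k) (u \<star> y) = ((\<star>) u ^^ Suc k) y" by (simp only: funpow_Suc_right o_def)
    finally show ?case by simp
  qed simp
  have "((\<star>) u ^^ N) u \<in> ((\<star>) u ^^ (N + Suc N)) ` V" using N u by blast
  then obtain x where x: "x \<in> V" "((\<star>) u ^^ N) u = ((\<star>) u ^^ (N + Suc N)) x" by blast
  define m where "m = ((\<star>) u ^^ N) x"
  have m_im: "m \<in> ((\<star>) u ^^ N) ` V" using x m_def by blast
  have mV: "m \<in> V"
  proof -
    have "((\<star>) u ^^ k) x \<in> V" for k by (cases k) (use x in auto)
    then show ?thesis by (simp add: m_def)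
  qed
  have fix_u: "((\<star>) u ^^ N) (u \<star> m) = ((\<star>) u ^^ N) u"
  proof -
    have "((\<star>) u ^^ N) (u \<star> m) = ((\<star>) u ^^ N) (((\<star>) u ^^ Suc N) x)" by (simp add: m_def)
    also have "\<dots> = ((\<star>) u ^^ N) u" using x(2) by (simp only: funpow_add o_def)
    finally show ?thesis .
  qed
  define c where "c v = v - v \<star> m" for v
  have cocycle: "c (com v v') = v \<star> c v' - v' \<star> c v" for v v'
    by (simp add: c_def com_mult) (simp add: com_def algebra_simps)
  have cV: "c v \<in> V" if "v \<in> V" for v using that by (simp add: c_def)
  have "((\<star>) u ^^ N) (c u) = 0"
    using fix_u by (simp add: c_def linear_diff[OF power_linear])
  then have cu: "c u \<in> null_component u" using cV u by (auto simp: null_component_def)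
  obtain n where n: "\<And>v. v \<in> V \<Longrightarrow> (com u ^^ n) v = 0" using ad_nilpotent[OF u] by metis
  have c_null: "c v \<in> null_component u" if "v \<in> V" for v
  proof -
    have "c v \<in> null_component u" if "v \<in> V" "(com u ^^ j) v = 0" for j v
      using that
    proof (induction j arbitrary: v)
      case 0
      then show ?case by (simp add: c_def null_component_zero)
    next
      case (Suc j)
      have "(com u ^^ j) (com u v) = 0"
        using Suc.prems(2) by (simp only: funpow_Suc_right o_def)
      then have "c (com u v) \<in> null_component u" by (intro Suc.IH) auto
      moreover have "v \<star> c u \<in> null_component u"
        using null_component_mult[OF _ _ cu] n Suc.prems by blast
      ultimately have "c (com u v) + v \<star> c u \<in> null_component u" by (rule null_component_add)
      then have "u \<star> c v \<in> null_component u" by (simp add: cocycle)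
      then show ?case using null_component_lift cV Suc.prems by blast
    qed
    then show ?thesis using that n by blast
  qed
  have orth: "\<langle>y, m\<rangle> = 0" if y: "y \<in> null_component u" for y
  proof -
    obtain k where k: "((\<star>) u ^^ k) y = 0" using y by (auto simp: null_component_def)
    have "((\<star>) u ^^ N) ` V = ((\<star>) u ^^ (k + N)) ` V" using N[of k] by (simp only: add.commute)
    then obtain z where "m = ((\<star>) u ^^ (k + N)) z" using m_im by blast
    then have "m = ((\<star>) u ^^ k) (((\<star>) u ^^ N) z)" by (simp only: funpow_add o_def)
    then show ?thesis using skew_power[of k y] k by simp
  qed
  have "m = 0"
  proof (rule eq_zeroI[OF mV])
    fix v assume "v \<in> V"
    then have "\<langle>c v, m\<rangle> = 0" using orth c_null by blast
    then show "\<langle>m, v\<rangle> = 0" by (simp add: c_def mult_self_pairing form_sym[of m v])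
  qed
  then have "w \<in> null_component u" using c_null[OF w] by (simp add: c_def)
  then show ?thesis by (simp add: null_component_def)
qed

end

section \<open>The isotropic plane of a central element\<close>

text \<open>
  The critical configuration: no nonzero element of the derived algebra acts trivially from the left
  (\<open>faithful\<close>), and \<open>c\<close> is a central element of the derived algebra with \<open>L\<^sub>c \<noteq> 0\<close>. The image of \<open>L\<^sub>c\<close> is a
  totally isotropic plane with basis \<open>c \<star> p\<close>, \<open>c \<star> q\<close>, on which pairing with \<open>q\<close> and \<open>- p\<close> gives the
  coordinates; \<open>maximal\<close> says that this plane contains every non-positive vector orthogonal to it.
\<close>

locale isotropic_central_plane = nilpotent_flat_algebra F V mult
  for F :: "'a::real_vector \<Rightarrow> 'a \<Rightarrow> real" (\<open>\<langle>_, _\<rangle>\<close>)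
    and V and mult (infixl \<open>\<star>\<close> 70) +
  fixes c p q :: 'a
  assumes c_derived: "c \<in> lc 1"
    and c_central: "\<And>u. u \<in> V \<Longrightarrow> com u c = 0"
    and pV: "p \<in> V" and qV: "q \<in> V"
    and pairing: "\<langle>c \<star> p, q\<rangle> = 1"
    and maximal: "\<And>x. x \<in> V \<Longrightarrow> \<langle>x, c \<star> p\<rangle> = 0 \<Longrightarrow> \<langle>x, c \<star> q\<rangle> = 0 \<Longrightarrow> \<langle>x, x\<rangle> \<le> 0 \<Longrightarrow>
      x = \<langle>x, q\<rangle> *\<^sub>R (c \<star> p) - \<langle>x, p\<rangle> *\<^sub>R (c \<star> q)"
    and faithful: "\<And>x. x \<in> lc 1 \<Longrightarrow> (\<And>w. w \<in> V \<Longrightarrow> x \<star> w = 0) \<Longrightarrow> x = 0"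
begin

definition plane :: "'a set" where "plane = (\<star>) c ` V"

definition perp :: "'a set" where "perp = {x \<in> V. \<forall>y\<in>plane. \<langle>x, y\<rangle> = 0}"

lemma cV: "c \<in> V"
  using c_derived lc_subset by blast

lemma c_commutes: "u \<in> V \<Longrightarrow> u \<star> c = c \<star> u"
  using c_central[of u] by (simp add: com_def)

lemma c_mult_commutes: "u \<in> V \<Longrightarrow> c \<star> (u \<star> w) = u \<star> (c \<star> w)"
  using c_central[of u] com_mult[of u c w] by simp

lemma c_square_zero: "w \<in> V \<Longrightarrow> c \<star> (c \<star> w) = 0"
  using c_mult_commutes[of w c] c_commutes[of w] central_square[OF cV c_central] by simp

lemma plane_subset_V: "x \<in> plane \<Longrightarrow> x \<in> V"
  by (auto simp: plane_def)

lemma perp_subset_V: "x \<in> perp \<Longrightarrow> x \<in> V"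
  by (simp add: perp_def)

lemma plane_isotropic: "x \<in> plane \<Longrightarrow> y \<in> plane \<Longrightarrow> \<langle>x, y\<rangle> = 0"
  by (auto simp: plane_def mult_skew[of c] c_square_zero)

lemma plane_subset_perp: "x \<in> plane \<Longrightarrow> x \<in> perp"
  by (simp add: perp_def plane_isotropic plane_subset_V)

lemma plane_members: "c \<star> p \<in> plane" "c \<star> q \<in> plane"
  using pV qV by (auto simp: plane_def)

lemma plane_scale: "x \<in> plane \<Longrightarrow> r *\<^sub>R x \<in> plane"
  by (auto simp: plane_def) (metis V_closed(4) bilinear_rmul[OF mult_bilinear] image_eqI)

lemma perp_isotropic_coords:
  assumes "x \<in> perp" "\<langle>x, x\<rangle> \<le> 0"
  shows "x = \<langle>x, q\<rangle> *\<^sub>R (c \<star> p) - \<langle>x, p\<rangle> *\<^sub>R (c \<star> q)"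
  using assms maximal plane_members by (auto simp: perp_def)

lemma perp_isotropic_in_plane:
  assumes "x \<in> perp" "\<langle>x, x\<rangle> \<le> 0"
  shows "x \<in> plane"
proof -
  have "x = c \<star> (\<langle>x, q\<rangle> *\<^sub>R p - \<langle>x, p\<rangle> *\<^sub>R q)"
    using perp_isotropic_coords[OF assms] by simp
  moreover have "\<langle>x, q\<rangle> *\<^sub>R p - \<langle>x, p\<rangle> *\<^sub>R q \<in> V" using pV qV by simp
  ultimately show ?thesis unfolding plane_def by (rule image_eqI)
qed

lemma plane_coords: "x \<in> plane \<Longrightarrow> x = \<langle>x, q\<rangle> *\<^sub>R (c \<star> p) - \<langle>x, p\<rangle> *\<^sub>R (c \<star> q)"
  by (simp add: perp_isotropic_coords plane_subset_perp plane_isotropic)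

lemma plane_invariant: "u \<in> V \<Longrightarrow> x \<in> plane \<Longrightarrow> u \<star> x \<in> plane"
  unfolding plane_def using c_mult_commutes[symmetric] by auto

lemma perp_invariant: "u \<in> V \<Longrightarrow> x \<in> perp \<Longrightarrow> u \<star> x \<in> perp"
  by (simp add: perp_def mult_skew[of u] plane_invariant)

text \<open>
  On \<open>perp / plane\<close> the form is positive definite, and a nilpotent skew map of a definite space is zero.
\<close>

lemma mult_perp_in_plane:
  assumes u: "u \<in> V" and x: "x \<in> perp"
  shows "u \<star> x \<in> plane"
proof -
  obtain k where k: "((\<star>) u ^^ k) x = 0"
    using left_mult_nilpotent[OF u] perp_subset_V[OF x] by blast
  have inv: "((\<star>) u ^^ j) x \<in> perp" for j
    by (induction j) (use x u perp_invariant in auto)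
  have "((\<star>) u ^^ Suc j) x \<in> plane" if "((\<star>) u ^^ (Suc j + i)) x \<in> plane" for i j
    using that
  proof (induction i)
    case (Suc i)
    let ?y = "((\<star>) u ^^ (j + i)) x"
    have "\<langle>u \<star> ?y, u \<star> ?y\<rangle> = - \<langle>?y, u \<star> (u \<star> ?y)\<rangle>" by (rule mult_skew)
    also have "\<dots> = 0" using Suc.prems inv[of "j + i"] by (simp add: perp_def)
    finally have "((\<star>) u ^^ (Suc j + i)) x \<in> plane"
      using perp_isotropic_in_plane[OF inv[of "Suc j + i"]] by simp
    then show ?case by (rule Suc.IH)
  qed simp
  moreover have "((\<star>) u ^^ (Suc 0 + k)) x \<in> plane"
    using k plane_scale[OF plane_members(1), of 0] by simp
  ultimately show ?thesis by fastforce
qed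

text \<open>
  The vectors \<open>x\<close>, \<open>y\<close> are independent since \<open>u\<close> kills the first but not the second; the coefficients
  of \<open>z\<close> come from Cramer's rule in the coordinates with respect to \<open>c \<star> p\<close> and \<open>c \<star> q\<close>.
\<close>

lemma plane_two_dimensional:
  assumes x: "x \<in> plane" "x \<noteq> 0" "u \<star> x = 0" and y: "y \<in> plane" "u \<star> y = x"
    and z: "z \<in> plane"
  obtains s t where "z = s *\<^sub>R x + t *\<^sub>R y"
proof -
  let ?a = "c \<star> p" and ?b = "c \<star> q"
  obtain x1 x2 where xc: "x = x1 *\<^sub>R ?a + x2 *\<^sub>R ?b"
    using plane_coords[OF x(1)] by (metis diff_conv_add_uminus scaleR_minus_left)
  obtain y1 y2 where yc: "y = y1 *\<^sub>R ?a + y2 *\<^sub>R ?b"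
    using plane_coords[OF y(1)] by (metis diff_conv_add_uminus scaleR_minus_left)
  obtain z1 z2 where zc: "z = z1 *\<^sub>R ?a + z2 *\<^sub>R ?b"
    using plane_coords[OF z] by (metis diff_conv_add_uminus scaleR_minus_left)
  define d where "d = x1 * y2 - y1 * x2"
  have "d \<noteq> 0"
  proof
    assume d: "d = 0"
    have "x1 *\<^sub>R y - y1 *\<^sub>R x = d *\<^sub>R ?b" "x2 *\<^sub>R y - y2 *\<^sub>R x = - d *\<^sub>R ?a"
      unfolding xc yc d_def by (simp_all add: algebra_simps)
    then have "x1 *\<^sub>R y = y1 *\<^sub>R x" "x2 *\<^sub>R y = y2 *\<^sub>R x" using d by auto
    then have "u \<star> (x1 *\<^sub>R y) = u \<star> (y1 *\<^sub>R x)" "u \<star> (x2 *\<^sub>R y) = u \<star> (y2 *\<^sub>R x)" by simp_all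
    then have "x1 = 0" "x2 = 0" using x y by simp_all
    then show False using x xc by simp
  qed
  have "d *\<^sub>R z = (z1 * y2 - y1 * z2) *\<^sub>R x + (x1 * z2 - z1 * x2) *\<^sub>R y"
    unfolding xc yc zc d_def by (simp add: algebra_simps)
  then have "(1 / d) *\<^sub>R (d *\<^sub>R z) =
      ((z1 * y2 - y1 * z2) / d) *\<^sub>R x + ((x1 * z2 - z1 * x2) / d) *\<^sub>R y"
    by (simp add: scaleR_add_right)
  then show ?thesis using that \<open>d \<noteq> 0\<close> by simp
qed

text \<open>
  A nilpotent map of a plane has square zero: a longer chain would make \<open>u \<star> (u \<star> y)\<close>, \<open>u \<star> y\<close>, \<open>y\<close>
  independent.
\<close>

lemma mult_square_plane:
  assumes u: "u \<in> V" and w: "w \<in> plane"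
  shows "u \<star> (u \<star> w) = 0"
proof (rule ccontr)
  assume nz: "u \<star> (u \<star> w) \<noteq> 0"
  define P where "P k \<longleftrightarrow> ((\<star>) u ^^ k) w = 0" for k
  obtain k where k: "P k" "\<And>j. j < k \<Longrightarrow> \<not> P j"
    using left_mult_nilpotent[OF u plane_subset_V[OF w]] exists_least_iff[of P] by (auto simp: P_def)
  have "\<not> P 0" "\<not> P 1" "\<not> P 2" using nz by (auto simp: P_def numeral_2_eq_2)
  then have "k \<noteq> 0 \<and> k \<noteq> 1 \<and> k \<noteq> 2" using k(1) by metis
  then obtain j where j: "k = Suc (Suc (Suc j))"
    by (metis One_nat_def Suc_1 not0_implies_Suc)
  define y where "y = ((\<star>) u ^^ j) w"
  have yW: "y \<in> plane" unfolding y_def by (induction j) (use w u plane_invariant in auto)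
  have uuu: "u \<star> (u \<star> (u \<star> y)) = 0" using k(1) by (simp add: P_def j y_def)
  have uu: "u \<star> (u \<star> y) \<noteq> 0" using k(2)[of "Suc (Suc j)"] by (simp add: P_def j y_def)
  obtain s t where st: "y = s *\<^sub>R (u \<star> (u \<star> y)) + t *\<^sub>R (u \<star> y)"
    using plane_two_dimensional[of "u \<star> (u \<star> y)" u "u \<star> y" y] uu uuu yW plane_invariant[OF u] by blast
  have "u \<star> (u \<star> y) = u \<star> (u \<star> (s *\<^sub>R (u \<star> (u \<star> y)) + t *\<^sub>R (u \<star> y)))"
    using st by simp
  then show False using uu uuu by simp
qed

text \<open>
  Engel's theorem for the plane. If \<open>u \<star> w \<noteq> 0\<close>, then \<open>e = u \<star> w\<close> spans the kernel of \<open>u\<close> on the plane; polarizing the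
  square-zero law gives \<open>u \<star> (v \<star> e) = - v \<star> (u \<star> e) = 0\<close>, so \<open>e\<close> is an eigenvector of every \<open>v\<close>, with
  eigenvalue zero by nilpotency.
\<close>

lemma common_kernel:
  obtains e where "e \<in> plane" "e \<noteq> 0" "\<And>u. u \<in> V \<Longrightarrow> u \<star> e = 0"
proof (cases "\<forall>u\<in>V. \<forall>w\<in>plane. u \<star> w = 0")
  case True
  have "c \<star> p \<noteq> 0" using pairing by auto
  then show ?thesis using True that plane_members by blast
next
  case False
  then obtain u w where u: "u \<in> V" and w: "w \<in> plane" and uw: "u \<star> w \<noteq> 0" by blast
  let ?e = "u \<star> w"
  have e: "?e \<in> plane" using plane_invariant u w by blast
  have "v \<star> ?e = 0" if v: "v \<in> V" for v
  proof -
    have "(u + v) \<star> ((u + v) \<star> ?e) = 0" using u v e by (intro mult_square_plane) auto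
    then have "u \<star> (v \<star> ?e) = 0"
      using mult_square_plane[OF u w] mult_square_plane[OF u e] mult_square_plane[OF v e] by simp
    moreover obtain s t where st: "v \<star> ?e = s *\<^sub>R ?e + t *\<^sub>R w"
      using plane_two_dimensional[OF e uw mult_square_plane[OF u w] w refl plane_invariant[OF v e]]
      by blast
    ultimately have "t *\<^sub>R ?e = 0" using mult_square_plane[OF u w] by simp
    then have se: "v \<star> ?e = s *\<^sub>R ?e" using st uw by simp
    then have "v \<star> (v \<star> ?e) = (s * s) *\<^sub>R ?e" by simp
    then show ?thesis using mult_square_plane[OF v e] se uw by simp
  qed
  then show ?thesis using that e uw by blast
qed

lemma mult_plane_in_line:
  assumes e: "e \<in> plane" "e \<noteq> 0" "\<And>u. u \<in> V \<Longrightarrow> u \<star> e = 0" and u: "u \<in> V" and w: "w \<in> plane"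
  obtains r where "u \<star> w = r *\<^sub>R e"
proof (cases "u \<star> w = 0")
  case True
  then show ?thesis using that[of 0] by simp
next
  case False
  obtain s t where st: "e = s *\<^sub>R (u \<star> w) + t *\<^sub>R w"
    using plane_two_dimensional[OF plane_invariant[OF u w] False mult_square_plane[OF u w] w refl e(1)]
    by blast
  have "u \<star> (s *\<^sub>R (u \<star> w) + t *\<^sub>R w) = 0" using e(3)[OF u] st by simp
  then have "t = 0" using False mult_square_plane[OF u w] by simp
  then have "e = s *\<^sub>R (u \<star> w)" "s \<noteq> 0" using st e(2) by auto
  then have "u \<star> w = (1 / s) *\<^sub>R e" by simp
  then show ?thesis using that by blast
qed

text \<open>
  A skew map with image in a plane is the contraction with a bivector of that plane, and these form a line
  containing \<open>L\<^sub>c\<close>.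
\<close>

lemma skew_map_proportional:
  assumes T: "\<And>x. x \<in> V \<Longrightarrow> T x \<in> plane"
    and skew: "\<And>x y. x \<in> V \<Longrightarrow> y \<in> V \<Longrightarrow> \<langle>T x, y\<rangle> = - \<langle>x, T y\<rangle>"
  obtains r where "\<And>x. x \<in> V \<Longrightarrow> T x = r *\<^sub>R (c \<star> x)"
proof -
  have formula: "T x = (\<langle>T p, q\<rangle>) *\<^sub>R (\<langle>x, c \<star> p\<rangle> *\<^sub>R (c \<star> q) - \<langle>x, c \<star> q\<rangle> *\<^sub>R (c \<star> p))"
    if T: "\<And>x. x \<in> V \<Longrightarrow> T x \<in> plane"
      and skew: "\<And>x y. x \<in> V \<Longrightarrow> y \<in> V \<Longrightarrow> \<langle>T x, y\<rangle> = - \<langle>x, T y\<rangle>" and x: "x \<in> V" for T x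
  proof -
    have pp: "\<langle>T p, p\<rangle> = 0" and qq: "\<langle>T q, q\<rangle> = 0" and qp: "\<langle>T q, p\<rangle> = - \<langle>T p, q\<rangle>"
      using skew[OF pV pV] skew[OF qV qV] skew[OF qV pV] form_sym[of p "T p"] form_sym[of q "T q"]
        form_sym[of q "T p"] by simp_all
    have Tp: "T p = \<langle>T p, q\<rangle> *\<^sub>R (c \<star> p)" using plane_coords[OF T[OF pV]] pp by simp
    have Tq: "T q = \<langle>T p, q\<rangle> *\<^sub>R (c \<star> q)" using plane_coords[OF T[OF qV]] qq qp by simp
    have Txq: "\<langle>T x, q\<rangle> = - (\<langle>T p, q\<rangle> * \<langle>x, c \<star> q\<rangle>)"
      using skew[OF x qV] arg_cong[OF Tq, of "F x"] by simp
    have Txp: "\<langle>T x, p\<rangle> = - (\<langle>T p, q\<rangle> * \<langle>x, c \<star> p\<rangle>)"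
      using skew[OF x pV] arg_cong[OF Tp, of "F x"] by simp
    have "T x = \<langle>T x, q\<rangle> *\<^sub>R (c \<star> p) - \<langle>T x, p\<rangle> *\<^sub>R (c \<star> q)"
      using plane_coords[OF T[OF x]] .
    also have "\<dots> = \<langle>T p, q\<rangle> *\<^sub>R (\<langle>x, c \<star> p\<rangle> *\<^sub>R (c \<star> q) - \<langle>x, c \<star> q\<rangle> *\<^sub>R (c \<star> p))"
      unfolding Txq Txp by (simp add: algebra_simps)
    finally show ?thesis .
  qed
  have "T x = \<langle>T p, q\<rangle> *\<^sub>R (c \<star> x)" if x: "x \<in> V" for x
  proof -
    have "c \<star> x = \<langle>c \<star> p, q\<rangle> *\<^sub>R (\<langle>x, c \<star> p\<rangle> *\<^sub>R (c \<star> q) - \<langle>x, c \<star> q\<rangle> *\<^sub>R (c \<star> p))"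
      using formula[of "(\<star>) c" x] x mult_skew[of c] by (auto simp: plane_def)
    then show ?thesis using formula[OF T skew x] pairing by simp
  qed
  then show ?thesis using that by blast
qed

text \<open>
  Otherwise \<open>c \<star> p = p \<star> c\<close> and \<open>c \<star> q = q \<star> c\<close> would both lie on the line into which all left
  multiplications map the plane, although they span the plane.
\<close>

lemma c_not_in_plane: "c \<notin> plane"
proof
  assume c: "c \<in> plane"
  obtain e where e: "e \<in> plane" "e \<noteq> 0" "\<And>u. u \<in> V \<Longrightarrow> u \<star> e = 0"
    using common_kernel by metis
  obtain s where s: "c \<star> p = s *\<^sub>R e"
    using mult_plane_in_line[OF e pV c] c_commutes[OF pV] by metis
  obtain t where t: "c \<star> q = t *\<^sub>R e"
    using mult_plane_in_line[OF e qV c] c_commutes[OF qV] by metis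
  have "s * \<langle>e, q\<rangle> = 1" using pairing s by simp
  moreover have "s * \<langle>e, p\<rangle> = 0" using mult_self_pairing[of c p] s by simp
  moreover have "t * \<langle>e, p\<rangle> = - 1"
    using mult_skew[of c q p] pairing form_sym[of q "c \<star> p"] t by simp
  ultimately show False by auto
qed

text \<open>
  The vector of the plane that all left multiplications kill also acts trivially itself. Two mechanisms are used repeatedly: an
  equation \<open>e \<star> w = r e\<close> makes \<open>- r\<close> an eigenvalue of the nilpotent \<open>ad w\<close>, and a skew map with image in the
  plane is a multiple of \<open>L\<^sub>c\<close>.
\<close>

theorem plane_meets_annihilator:
  obtains e where "e \<in> plane" "e \<noteq> 0" "\<And>u. u \<in> V \<Longrightarrow> u \<star> e = 0" "\<And>u. u \<in> V \<Longrightarrow> e \<star> u = 0"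
proof -
  obtain e where e: "e \<in> plane" "e \<noteq> 0" "\<And>u. u \<in> V \<Longrightarrow> u \<star> e = 0"
    using common_kernel by metis
  have eV: "e \<in> V" using e plane_subset_V by blast
  have eig: "r = 0" if "w \<in> V" "e \<star> w = r *\<^sub>R e" for w r
    using ad_eigenvalue_zero[OF that(1) eV e(2), of "- r"] that e(3) by (simp add: com_def)
  have e_plane: "e \<star> w = 0" if w: "w \<in> plane" for w
    using mult_plane_in_line[OF e eV w] eig plane_subset_V[OF w] by (metis scaleR_zero_left)
  have "e \<star> w \<in> plane" if w: "w \<in> V" for w
  proof -
    let ?x = "e \<star> w"
    have x_com: "?x = com e w" using e(3)[OF w] by (simp add: com_def)
    have x_perp: "?x \<in> perp"
      by (simp add: perp_def mult_skew[of e] e_plane)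
    have x_plane: "?x \<star> y = 0" if "y \<in> plane" for y
      unfolding x_com com_mult using that w by (simp add: e_plane plane_invariant)
    \<comment> \<open>Faithfulness will give \<open>[e, x] = r c\<close>. As the left side lies in the plane and \<open>c\<close> does not, \<open>r = 0\<close>.\<close>
    define T where "T = (\<star>) (com e ?x)"
    have T_perp: "T y = 0" if "y \<in> perp" for y
      unfolding T_def com_mult using that eV by (simp add: mult_perp_in_plane e_plane x_plane)
    have "T y \<in> plane" if "y \<in> V" for y
    proof (rule perp_isotropic_in_plane)
      show Tp: "T y \<in> perp"
        using T_perp plane_subset_perp unfolding T_def perp_def by (simp add: mult_skew[of "com _ _"])
      have "\<langle>T y, T y\<rangle> = - \<langle>y, T (T y)\<rangle>" unfolding T_def by (rule mult_skew)
      then show "\<langle>T y, T y\<rangle> \<le> 0" using T_perp[OF Tp] by simp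
    qed
    moreover have "\<langle>T y, z\<rangle> = - \<langle>y, T z\<rangle>" for y z unfolding T_def by (rule mult_skew)
    ultimately obtain r where r: "\<And>y. y \<in> V \<Longrightarrow> T y = r *\<^sub>R (c \<star> y)"
      using skew_map_proportional[of T] by metis
    have "com e ?x - r *\<^sub>R c \<in> lc 1"
      using com_lc[of e ?x 0] eV c_derived
      by (intro subspace_diff subspace_scale subspace_lc) simp_all
    then have "com e ?x - r *\<^sub>R c = 0"
      by (rule faithful) (use r in \<open>simp add: T_def\<close>)
    then have ex: "e \<star> ?x = r *\<^sub>R c" using e(3)[of ?x] by (simp add: com_def)
    have "r = 0"
    proof (rule ccontr)
      assume "r \<noteq> 0"
      then have "c = (1 / r) *\<^sub>R (e \<star> ?x)" using ex by simp
      moreover have "e \<star> ?x \<in> plane" using mult_perp_in_plane[OF eV x_perp] .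
      ultimately show False using c_not_in_plane plane_scale by metis
    qed
    \<comment> \<open>Now \<open>e \<star> (e \<star> w) = 0\<close>, so \<open>e \<star> w\<close> is a null vector of \<open>perp\<close>.\<close>
    then have "\<langle>?x, ?x\<rangle> = 0" using mult_skew[of e w ?x] ex by simp
    then show ?thesis using perp_isotropic_in_plane[OF x_perp] by simp
  qed
  moreover have "\<langle>e \<star> x, y\<rangle> = - \<langle>x, e \<star> y\<rangle>" for x y by (rule mult_skew)
  ultimately obtain r where r: "\<And>x. x \<in> V \<Longrightarrow> e \<star> x = r *\<^sub>R (c \<star> x)"
    using skew_map_proportional[of "(\<star>) e"] by metis
  \<comment> \<open>\<open>e = c \<star> u\<close> gives \<open>e \<star> u = r (c \<star> u) = r e\<close>, an eigenvalue equation.\<close>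
  obtain u where "u \<in> V" "e = c \<star> u" using e(1) by (auto simp: plane_def)
  then have "r = 0" using eig r by metis
  then show ?thesis using that e r by simp
qed

end

section \<open>A null vector annihilated by both multiplications\<close>

context nilpotent_flat_algebra
begin

text \<open>
  The three cases are: the abelian one, where the product vanishes; a derived algebra that contains a
  nonzero element acting trivially, where such an element can be taken central; and the critical
  configuration \<open>isotropic_central_plane\<close>.
\<close>

theorem null_annihilator_exists:
  assumes sb: "signature_basis V N P" "card N = 2" "P \<noteq> {}"
  obtains e where "e \<in> V" "e \<noteq> 0" "\<langle>e, e\<rangle> = 0"
    "\<And>u. u \<in> V \<Longrightarrow> u \<star> e = 0" "\<And>u. u \<in> V \<Longrightarrow> e \<star> u = 0"
proof (cases "\<forall>u\<in>V. \<forall>v\<in>V. com u v = 0")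
  case True
  have zero: "u \<star> v = 0" if "u \<in> V" "v \<in> V" for u v
  proof (rule eq_zeroI)
    fix w assume "w \<in> V"
    then show "\<langle>u \<star> v, w\<rangle> = 0" using koszul[of u v w] True that by simp
  qed simp
  have "N \<noteq> {}" using sb(2) by auto
  then obtain n p where np: "n \<in> N" "p \<in> P" using sb(3) by blast
  then have neg: "\<langle>n, n\<rangle> < 0" and pos: "\<langle>p, p\<rangle> > 0" using sb(1) by (auto simp: signature_basis_def)
  then have "n \<noteq> p" by auto
  then have orth: "\<langle>n, p\<rangle> = 0" "\<langle>p, n\<rangle> = 0"
    using np sb(1) by (auto simp: signature_basis_def orthogonal_family_def)
  have nV: "n \<in> V" "p \<in> V" using np sb(1) span_base[of _ "N \<union> P"] by (auto simp: signature_basis_def)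
  define e where "e = sqrt \<langle>p, p\<rangle> *\<^sub>R n + sqrt (- \<langle>n, n\<rangle>) *\<^sub>R p"
  have "\<langle>e, e\<rangle> = (sqrt \<langle>p, p\<rangle> * sqrt \<langle>p, p\<rangle>) * \<langle>n, n\<rangle> +
      (sqrt (- \<langle>n, n\<rangle>) * sqrt (- \<langle>n, n\<rangle>)) * \<langle>p, p\<rangle>"
    by (simp add: e_def orth del: real_sqrt_mult_self)
  also have "\<dots> = \<langle>p, p\<rangle> * \<langle>n, n\<rangle> + (- \<langle>n, n\<rangle>) * \<langle>p, p\<rangle>"
    using neg pos by (simp only: real_sqrt_mult_self abs_of_pos abs_of_neg neg_0_less_iff_less)
  also have "\<dots> = 0" by simp
  finally have "\<langle>e, e\<rangle> = 0" .
  moreover have "\<langle>e, n\<rangle> \<noteq> 0" using neg pos by (simp add: e_def orth)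
  then have "e \<noteq> 0" by auto
  moreover have "e \<in> V" using nV by (simp add: e_def)
  ultimately show ?thesis using that zero by blast
next
  case False
  then obtain y where y: "y \<in> lc 1" "y \<noteq> 0"
    using com_lc[of _ _ 0] by (metis One_nat_def form_lie_algebra.select_convs(1) lower_central.simps(1))
  show ?thesis
  proof (cases "\<exists>x \<in> lc 1. x \<noteq> 0 \<and> (\<forall>w\<in>V. x \<star> w = 0)")
    case True
    define J where "J = {x \<in> lc 1. \<forall>w\<in>V. x \<star> w = 0}"
    obtain x where "x \<in> J" "x \<noteq> 0" using True by (auto simp: J_def)
    moreover have "J \<subseteq> V" using lc_subset unfolding J_def by blast
    moreover have "com u z \<in> J" if "u \<in> V" "z \<in> J" for u z
      using that com_lc[of u z 0] lc_subset[of 1] by (auto simp: J_def com_mult)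
    ultimately obtain e where e: "e \<in> J" "e \<noteq> 0" "\<And>u. u \<in> V \<Longrightarrow> com u e = 0"
      using central_element_exists by metis
    have eL: "e \<star> u = 0" if "u \<in> V" for u using e that by (auto simp: J_def)
    have eR: "u \<star> e = 0" if "u \<in> V" for u using e(3)[OF that] eL[OF that] by (simp add: com_def)
    \<comment> \<open>\<open>e\<close> is orthogonal to the derived algebra, which contains it.\<close>
    have "\<langle>e, x\<rangle> = 0" if "x \<in> span {com x y |x y. x \<in> V \<and> y \<in> V}" for x
      using that
    proof (induction rule: span_induct_alt)
      case (step r z x)
      then obtain u v where uv: "z = com u v" "u \<in> V" "v \<in> V" by blast
      then have "\<langle>e, z\<rangle> = 0"
        using mult_skew[of u v e] mult_skew[of v u e] eR form_sym[of e]
        by (simp add: com_def)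
      then show ?case using step by simp
    qed simp
    then have "\<langle>e, e\<rangle> = 0" using e(1) by (simp add: J_def)
    moreover have "e \<in> V" using e \<open>J \<subseteq> V\<close> by blast
    ultimately show ?thesis using that e(2) eL eR by blast
  next
    case False
    obtain c where c: "c \<in> lc 1" "c \<noteq> 0" "\<And>u. u \<in> V \<Longrightarrow> com u c = 0"
      using central_element_exists[of y "lc 1"] y lc_subset com_lc
      by (metis One_nat_def lc_subset com_lc subsetD lower_central.simps(1) form_lie_algebra.select_convs(1))
    have cV: "c \<in> V" using c lc_subset by blast
    obtain p where p: "p \<in> V" "c \<star> p \<noteq> 0" using False c by blast
    then obtain z where z: "z \<in> V" "\<langle>c \<star> p, z\<rangle> \<noteq> 0" using eq_zeroI mult_closed by blast
    define q where "q = (1 / \<langle>c \<star> p, z\<rangle>) *\<^sub>R z"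
    have q: "q \<in> V" "\<langle>c \<star> p, q\<rangle> = 1" using z by (simp_all add: q_def)
    have sq: "c \<star> (c \<star> w) = 0" if "w \<in> V" for w
    proof -
      have "w \<star> c = c \<star> w" using c(3)[OF that] by (simp add: com_def)
      moreover have "w \<star> (c \<star> c) - c \<star> (w \<star> c) = 0" using com_mult[of w c c] c(3)[OF that] by simp
      ultimately show ?thesis using central_square[OF cV c(3)] by simp
    qed
    interpret isotropic_central_plane F V mult c p q
    proof unfold_locales
      fix x assume x: "x \<in> V" "\<langle>x, c \<star> p\<rangle> = 0" "\<langle>x, c \<star> q\<rangle> = 0" "\<langle>x, x\<rangle> \<le> 0"
      show "x = \<langle>x, q\<rangle> *\<^sub>R (c \<star> p) - \<langle>x, p\<rangle> *\<^sub>R (c \<star> q)"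
      proof (rule isotropic_plane_maximal[OF subspace_V sb(1,2) _ _ _ _ _ _ _ _ _ x])
        show "\<langle>c \<star> q, p\<rangle> = - 1" using mult_skew[of c q p] q form_sym[of q "c \<star> p"] by simp
      qed (use p q sq in \<open>simp_all add: mult_self_pairing mult_skew[of c _ "c \<star> _"]\<close>)
    qed (use c p q False in auto)
    obtain e where "e \<in> plane" "e \<noteq> 0" "\<And>u. u \<in> V \<Longrightarrow> u \<star> e = 0" "\<And>u. u \<in> V \<Longrightarrow> e \<star> u = 0"
      using plane_meets_annihilator by metis
    then show ?thesis using that plane_subset_V plane_isotropic by blast
  qed
qed

end

section \<open>Reduction along a null annihilator\<close>

lemma linear_betweenI:
  "linear f \<Longrightarrow> (\<And>x. x \<in> U \<Longrightarrow> f x \<in> W) \<Longrightarrow> linear_between U W f"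
  by (simp add: linear_between_def linear_add linear_scale)

lemma bilinear_betweenI:
  "bilinear f \<Longrightarrow> (\<And>x y. x \<in> U \<Longrightarrow> y \<in> U \<Longrightarrow> f x y \<in> W) \<Longrightarrow> bilinear_between U W f"
  by (auto simp: bilinear_between_def bilinear_def intro!: linear_betweenI)

lemma (in symmetric_form) levi_civita_eqI:
  assumes "subspace W" "nondegenerate_on W" "x \<in> W"
    and x: "\<And>w. w \<in> W \<Longrightarrow> 2 * \<langle>x, w\<rangle> = \<langle>br u v, w\<rangle> + \<langle>br w u, v\<rangle> + \<langle>br w v, u\<rangle>"
  shows "levi_civita \<lparr>carrier = W, bracket = br, form = F\<rparr> u v = x"
  unfolding levi_civita_def
proof (rule the_equality)
  fix y
  assume y: "y \<in> carrier \<lparr>carrier = W, bracket = br, form = F\<rparr> \<and>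
    (\<forall>w\<in>carrier \<lparr>carrier = W, bracket = br, form = F\<rparr>. 2 * form \<lparr>carrier = W, bracket = br, form = F\<rparr> y w =
      form \<lparr>carrier = W, bracket = br, form = F\<rparr> (bracket \<lparr>carrier = W, bracket = br, form = F\<rparr> u v) w +
      form \<lparr>carrier = W, bracket = br, form = F\<rparr> (bracket \<lparr>carrier = W, bracket = br, form = F\<rparr> w u) v +
      form \<lparr>carrier = W, bracket = br, form = F\<rparr> (bracket \<lparr>carrier = W, bracket = br, form = F\<rparr> w v) u)"
  have "\<langle>y - x, w\<rangle> = 0" if "w \<in> W" for w
  proof -
    have "2 * \<langle>y, w\<rangle> = 2 * \<langle>x, w\<rangle>" unfolding x[OF that] using y that by simp
    then show ?thesis by simp
  qed
  moreover have "y - x \<in> W" using y assms(1,3) by (simp add: subspace_diff)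
  ultimately have "y - x = 0" using assms(2) unfolding nondegenerate_on_def by blast
  then show "y = x" by simp
qed (use assms in auto)

text \<open>
  The vectors \<open>e\<close>, \<open>e'\<close> span a hyperbolic plane whose orthogonal complement \<open>B\<close> represents the
  quotient of \<open>e\<^sup>\<bottom>\<close> by \<open>\<real>e\<close>. Since \<open>e\<close> annihilates everything and all products are orthogonal to \<open>e\<close>, the
  projection to \<open>B\<close> may be dropped inside products (\<open>proj_mult_left\<close>, \<open>proj_mult_right\<close>); every identity
  of the reduced algebra is therefore the projection of an identity of the original one.
\<close>

locale null_reduction = flat_metric_algebra F V mult
  for F :: "'a::real_vector \<Rightarrow> 'a \<Rightarrow> real" (\<open>\<langle>_, _\<rangle>\<close>)
    and V and mult (infixl \<open>\<star>\<close> 70) +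
  fixes e e' :: 'a
  assumes eV: "e \<in> V" and e'V: "e' \<in> V"
    and ee [simp]: "\<langle>e, e\<rangle> = 0" and e'e' [simp]: "\<langle>e', e'\<rangle> = 0" and ee' [simp]: "\<langle>e, e'\<rangle> = 1"
    and mult_e: "u \<in> V \<Longrightarrow> u \<star> e = 0" and e_mult: "u \<in> V \<Longrightarrow> e \<star> u = 0"
begin

lemma e'e [simp]: "\<langle>e', e\<rangle> = 1"
  using form_sym[of e' e] by simp

definition B :: "'a set" where "B = {x \<in> V. \<langle>x, e\<rangle> = 0 \<and> \<langle>x, e'\<rangle> = 0}"

definition proj :: "'a \<Rightarrow> 'a" where "proj x = x - \<langle>x, e'\<rangle> *\<^sub>R e - \<langle>x, e\<rangle> *\<^sub>R e'"

definition reduction :: "'a form_lie_algebra" where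
  "reduction = \<lparr>carrier = B, bracket = (\<lambda>a b. proj (com a b)), form = F\<rparr>"

definition \<xi> :: "'a \<Rightarrow> 'a" where "\<xi> a = - proj (a \<star> e')"

definition D :: "'a \<Rightarrow> 'a" where "D a = proj (com e' a)"

definition b\<^sub>0 :: 'a where "b\<^sub>0 = e' \<star> e'"

lemma reduction_simps [simp]:
  "carrier reduction = B" "bracket reduction = (\<lambda>a b. proj (com a b))" "form reduction = F"
  by (simp_all add: reduction_def)

lemma BV: "x \<in> B \<Longrightarrow> x \<in> V"
  by (simp add: B_def)

lemma subspace_B: "subspace B"
  by (auto simp: B_def subspace_def)

lemma linear_proj: "linear proj"
  by (rule linearI) (simp_all add: proj_def algebra_simps)

lemmas proj_simps =
  linear_add[OF linear_proj] linear_diff[OF linear_proj]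
  linear_neg[OF linear_proj] linear_scale[OF linear_proj] linear_0[OF linear_proj]

lemma proj_V [simp]: "x \<in> V \<Longrightarrow> proj x \<in> V"
  using eV e'V by (simp add: proj_def)

lemma proj_B [simp]: "x \<in> V \<Longrightarrow> proj x \<in> B"
  by (simp add: B_def) (simp add: proj_def)

lemma proj_id: "x \<in> B \<Longrightarrow> proj x = x"
  by (simp add: B_def proj_def)

lemma decompose: "x = proj x + \<langle>x, e'\<rangle> *\<^sub>R e + \<langle>x, e\<rangle> *\<^sub>R e'"
  by (simp add: proj_def)

lemma proj_pairing: "b \<in> B \<Longrightarrow> \<langle>proj x, b\<rangle> = \<langle>x, b\<rangle>"
  by (simp add: B_def proj_def form_sym[of e b] form_sym[of e' b])

lemma mult_orth_e [simp]: "u \<in> V \<Longrightarrow> \<langle>u \<star> v, e\<rangle> = 0"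
  using mult_skew[of u v e] by (simp add: mult_e)

lemma com_orth_e [simp]: "u \<in> V \<Longrightarrow> v \<in> V \<Longrightarrow> \<langle>com u v, e\<rangle> = 0"
  by (simp add: com_def)

lemma com_e [simp]: "u \<in> V \<Longrightarrow> com u e = 0" "u \<in> V \<Longrightarrow> com e u = 0"
  by (simp_all add: com_def mult_e e_mult)

lemma proj_mult_left: "\<langle>x, e\<rangle> = 0 \<Longrightarrow> w \<in> V \<Longrightarrow> proj x \<star> w = x \<star> w"
  by (simp add: proj_def e_mult)

lemma proj_mult_right: "\<langle>x, e\<rangle> = 0 \<Longrightarrow> w \<in> V \<Longrightarrow> w \<star> proj x = w \<star> x"
  by (simp add: proj_def mult_e)

lemma proj_com: "\<langle>x, e\<rangle> = 0 \<Longrightarrow> w \<in> V \<Longrightarrow> com w (proj x) = com w x"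
  by (simp add: com_def proj_mult_left proj_mult_right)

lemma finite_span_B: "\<exists>S. finite S \<and> span S = B"
proof -
  obtain S where S: "finite S" "span S = V" using finite_span by blast
  have "proj ` V = B"
  proof
    show "B \<subseteq> proj ` V"
    proof
      fix x assume "x \<in> B"
      then show "x \<in> proj ` V" using proj_id BV by (metis image_eqI)
    qed
  qed auto
  then have "span (proj ` S) = B" using S by (simp add: linear_span_image[OF linear_proj])
  then show ?thesis using S by blast
qed

lemma nondegenerate_B: "nondegenerate_on B"
  unfolding nondegenerate_on_def
proof (intro ballI impI)
  fix x assume x: "x \<in> B" "\<forall>y\<in>B. \<langle>x, y\<rangle> = 0"
  show "x = 0"
  proof (rule eq_zeroI)
    fix y assume "y \<in> V"
    then have "\<langle>x, proj y\<rangle> = 0" using x by simp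
    then show "\<langle>x, y\<rangle> = 0" using x(1) by (simp add: proj_def B_def)
  qed (use x BV in blast)
qed

lemma linear_xi: "linear \<xi>"
  by (rule linearI) (simp_all add: \<xi>_def proj_simps)

lemma linear_D: "linear D"
  by (rule linearI) (simp_all add: D_def com_linear_simps proj_simps)

lemma reduction_levi_civita:
  assumes "a \<in> B" "b \<in> B"
  shows "levi_civita reduction a b = proj (a \<star> b)"
  unfolding reduction_def
proof (rule levi_civita_eqI[OF subspace_B nondegenerate_B])
  fix w assume "w \<in> B"
  then show "2 * \<langle>proj (a \<star> b), w\<rangle> =
      \<langle>proj (com a b), w\<rangle> + \<langle>proj (com w a), b\<rangle> + \<langle>proj (com w b), a\<rangle>"
    using assms koszul[of a b w] by (simp add: proj_pairing)
qed simp

lemma reduction_pseudo_euclidean: "pseudo_euclidean_lie_algebra reduction"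
proof -
  have "bilinear (\<lambda>a b. proj (com a b))"
    unfolding bilinear_def by (auto intro!: linearI simp: com_linear_simps proj_simps)
  then have "bilinear_between B B (\<lambda>a b. proj (com a b))"
    by (rule bilinear_betweenI) simp
  moreover have "proj (com x (proj (com y z))) + proj (com y (proj (com z x))) +
      proj (com z (proj (com x y))) = 0" if "x \<in> B" "y \<in> B" "z \<in> B" for x y z
    using that arg_cong[OF com_jacobi[of x y z], of proj] by (simp add: proj_com BV proj_simps)
  ultimately have "lie_algebra_on B (\<lambda>a b. proj (com a b))"
    by (simp add: lie_algebra_on_def proj_simps)
  moreover have "bilinear_between B UNIV F" by (rule bilinear_betweenI[OF form_bilinear]) simp
  ultimately show ?thesis
    using subspace_B finite_span_B nondegenerate_B form_sym
    by (simp add: pseudo_euclidean_lie_algebra_def finite_dimensional_def nondegenerate_on_def)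
qed

lemma reduction_flat: "flat reduction"
  unfolding flat_def
proof (intro ballI)
  fix u v w assume "u \<in> carrier reduction" "v \<in> carrier reduction" "w \<in> carrier reduction"
  then have B: "u \<in> B" "v \<in> B" "w \<in> B" by simp_all
  then have "levi_civita reduction (levi_civita reduction u v) w - levi_civita reduction u (levi_civita reduction v w) =
      proj ((u \<star> v) \<star> w - u \<star> (v \<star> w))"
    by (simp add: reduction_levi_civita proj_mult_left proj_mult_right BV proj_simps)
  also have "\<dots> = proj ((v \<star> u) \<star> w - v \<star> (u \<star> w))" by (simp only: left_symmetric)
  finally show "levi_civita reduction (levi_civita reduction u v) w - levi_civita reduction u (levi_civita reduction v w) =
      levi_civita reduction (levi_civita reduction v u) w - levi_civita reduction v (levi_civita reduction u w)"
    using B by (simp add: reduction_levi_civita proj_mult_left proj_mult_right BV proj_simps)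
qed

text \<open>
  The condition \<open>\<langle>x, e\<rangle> = 0\<close> is carried along so that the projection can be dropped in the next bracket.
\<close>

lemma reduction_lower_central: "lower_central reduction k \<subseteq> proj ` (lc k \<inter> {x. \<langle>x, e\<rangle> = 0})"
proof (induction k)
  case 0
  show ?case
  proof
    fix x assume "x \<in> lower_central reduction 0"
    then have "x \<in> B" by simp
    then show "x \<in> proj ` (lc 0 \<inter> {x. \<langle>x, e\<rangle> = 0})"
      by (intro image_eqI[of _ _ x]) (simp_all add: proj_id, simp add: B_def)
  qed
next
  case (Suc k)
  let ?C = "lc (Suc k) \<inter> {x. \<langle>x, e\<rangle> = 0}"
  have "subspace {x. \<langle>x, e\<rangle> = 0}" by (simp add: subspace_def)
  then have "subspace ?C" using subspace_lc subspace_inter by blast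
  then have sub: "subspace (proj ` ?C)" using linear_subspace_image[OF linear_proj] by blast
  show ?case
    unfolding lower_central.simps(2)[of reduction]
  proof (rule span_minimal[OF _ sub], clarify)
    fix x y assume x: "x \<in> carrier reduction" and y: "y \<in> lower_central reduction k"
    then obtain z where z: "z \<in> lc k" "\<langle>z, e\<rangle> = 0" "y = proj z" using Suc.IH by blast
    have xz: "x \<in> V" "z \<in> V" using x z lc_subset BV by auto
    then have "bracket reduction x y = proj (com x z)" using z by (simp add: proj_com)
    moreover have "com x z \<in> ?C" using com_lc[OF xz(1) z(1)] com_orth_e[OF xz] by blast
    ultimately show "bracket reduction x y \<in> proj ` ?C" by blast
  qed
qed

lemma reduction_nilpotent:
  assumes "nilpotent_lie_algebra alg"
  shows "nilpotent_lie_algebra reduction"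
proof -
  obtain k where "lc k = {0}" using assms by (auto simp: nilpotent_lie_algebra_def)
  then have "lower_central reduction k \<subseteq> {0}"
    using reduction_lower_central[of k] by (auto simp: proj_simps)
  moreover have "0 \<in> lower_central reduction k"
    by (cases k) (use subspace_B in \<open>auto simp: subspace_0 span_zero\<close>)
  ultimately show ?thesis unfolding nilpotent_lie_algebra_def by blast
qed

text \<open>
  Adding \<open>e - e'\<close> and \<open>e + e'\<close>, of square \<open>- 2\<close> and \<open>2\<close>, to an orthogonal basis of \<open>B\<close> gives an orthogonal basis
  of \<open>V\<close>, whose number of negative vectors is known by inertia.
\<close>

lemma reduction_lorentzian:
  assumes sb: "signature_basis V N P" "card N = 2"
  shows "lorentzian reduction"
proof -
  obtain S where S: "finite S" "B = span S" using finite_span_B by blast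
  obtain N' P' where sb': "signature_basis B N' P'"
    using signature_basis_exists[OF subspace_B S(2,1) nondegenerate_B] by blast
  have ortho: "orthogonal_family (N' \<union> P')" and spanB: "span (N' \<union> P') = B"
    and N': "\<And>u. u \<in> N' \<Longrightarrow> \<langle>u, u\<rangle> < 0" and P': "\<And>u. u \<in> P' \<Longrightarrow> \<langle>u, u\<rangle> > 0"
    using sb' by (auto simp: signature_basis_def)
  have fin: "finite N'" "finite P'" using ortho by (auto simp: orthogonal_family_def)
  have inB: "u \<in> B" if "u \<in> N' \<union> P'" for u using span_base[OF that] spanB by simp
  let ?N = "insert (e - e') N'" and ?P = "insert (e + e') P'"
  have perp: "\<langle>u, e\<rangle> = 0" "\<langle>u, e'\<rangle> = 0" "\<langle>e, u\<rangle> = 0" "\<langle>e', u\<rangle> = 0" if "u \<in> N' \<union> P'" for u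
  proof -
    show "\<langle>u, e\<rangle> = 0" "\<langle>u, e'\<rangle> = 0" using inB[OF that] unfolding B_def by blast+
    then show "\<langle>e, u\<rangle> = 0" "\<langle>e', u\<rangle> = 0" by (simp_all only: form_sym[of e u] form_sym[of e' u])
  qed
  have "orthogonal_family (?N \<union> ?P)"
    using ortho perp by (auto simp: orthogonal_family_def)
  moreover have "span (?N \<union> ?P) = V"
  proof
    show "span (?N \<union> ?P) \<subseteq> V"
      using inB BV eV e'V subspace_V by (intro span_minimal) auto
    show "V \<subseteq> span (?N \<union> ?P)"
    proof
      fix x assume "x \<in> V"
      then have "proj x \<in> span (N' \<union> P')" using spanB by simp
      then have 1: "proj x \<in> span (?N \<union> ?P)" using span_mono[of "N' \<union> P'" "?N \<union> ?P"] by blast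
      have m: "e - e' \<in> span (?N \<union> ?P)" "e + e' \<in> span (?N \<union> ?P)" by (auto intro: span_base)
      have "(1 / 2) *\<^sub>R ((e + e') + (e - e')) \<in> span (?N \<union> ?P)"
        "(1 / 2) *\<^sub>R ((e + e') - (e - e')) \<in> span (?N \<union> ?P)"
        by (intro span_scale span_add span_diff m)+
      moreover have "(1 / 2) *\<^sub>R ((e + e') + (e - e')) = e" "(1 / 2) *\<^sub>R ((e + e') - (e - e')) = e'"
        by (simp_all add: scaleR_2[symmetric])
      ultimately have "e \<in> span (?N \<union> ?P)" "e' \<in> span (?N \<union> ?P)" by simp_all
      then have "proj x + \<langle>x, e'\<rangle> *\<^sub>R e + \<langle>x, e\<rangle> *\<^sub>R e' \<in> span (?N \<union> ?P)"
        using 1 by (intro span_add span_scale)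
      then show "x \<in> span (?N \<union> ?P)" using decompose[of x] by simp
    qed
  qed
  ultimately have "signature_basis V ?N ?P"
    using N' P' by (auto simp: signature_basis_def)
  then have "card ?N = 2" using inertia[OF _ sb(1)] sb(2) by simp
  moreover have "e - e' \<notin> N'"
  proof
    assume "e - e' \<in> N'"
    then show False using perp[of "e - e'"] by simp
  qed
  ultimately have card: "card N' = 1" using fin by simp
  have disj: "N' \<inter> P' = {}" using N' P' by force
  have ind: "independent (N' \<union> P')" using orthogonal_independent[OF ortho] .
  have "dim B = card N' + card P'"
    using dim_span_eq_card_independent[OF ind] spanB fin disj by (simp add: card_Un_disjoint)
  then have "card P' = dim B - 1" using card by simp
  then show ?thesis
    unfolding lorentzian_def has_signature_def
    using ind spanB ortho N' P' disj card fin
    by (intro exI[of _ N'] exI[of _ P']) (simp add: orthogonal_family_def)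
qed

text \<open>
  \<open>D - \<xi>\<close> is the projection of \<open>L\<^bsub>e'\<^esub>\<close> and therefore skew. The other conditions are flatness on
  \<open>(a, b, e')\<close>, \<open>(e', a, e')\<close> and \<open>(e', a, b)\<close>.
\<close>

lemma reduction_admissible: "admissible reduction \<xi> D 0 b\<^sub>0"
proof -
  have xiB: "\<xi> a \<in> B" for a using subspace_neg[OF subspace_B] by (simp add: \<xi>_def)
  have DB: "D a \<in> B" for a by (simp add: D_def)
  have b0B: "b\<^sub>0 \<in> B" using mult_self_pairing[of e' e'] e'V by (simp add: b\<^sub>0_def B_def)
  have "\<xi> (proj (com a b)) = proj (a \<star> \<xi> b) - proj (b \<star> \<xi> a)" if "a \<in> B" "b \<in> B" for a b
  proof -
    have "\<xi> (proj (com a b)) = - proj (com a b \<star> e')"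
      using that by (simp add: \<xi>_def proj_mult_left BV e'V)
    also have "\<dots> = - proj (a \<star> (b \<star> e')) + proj (b \<star> (a \<star> e'))" by (simp add: com_mult proj_simps)
    also have "\<dots> = proj (a \<star> \<xi> b) - proj (b \<star> \<xi> a)"
      using that by (simp add: \<xi>_def proj_mult_right BV proj_simps)
    finally show ?thesis .
  qed
  moreover have "\<langle>D a - \<xi> a, b\<rangle> = - \<langle>a, D b - \<xi> b\<rangle>" if "a \<in> B" "b \<in> B" for a b
  proof -
    have "D x - \<xi> x = proj (e' \<star> x)" for x by (simp add: D_def \<xi>_def com_def proj_simps)
    then show ?thesis
      using that proj_pairing[of a "e' \<star> b"] proj_pairing[of b "e' \<star> a"] mult_skew[of e' a b]
        form_sym[of a "proj (e' \<star> b)"] form_sym[of a "e' \<star> b"] by simp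
  qed
  moreover have "D (\<xi> a) - \<xi> (D a) = \<xi> (\<xi> a) - proj (a \<star> b\<^sub>0)" if a: "a \<in> B" for a
  proof -
    have 1: "D (\<xi> a) = - proj (e' \<star> (a \<star> e')) + proj ((a \<star> e') \<star> e')"
      using a by (simp add: D_def \<xi>_def com_linear_simps proj_com proj_simps BV e'V)
        (simp add: com_def proj_simps)
    have 2: "\<xi> (D a) = - proj ((e' \<star> a) \<star> e') + proj ((a \<star> e') \<star> e')"
      using a by (simp add: D_def \<xi>_def proj_mult_left BV e'V) (simp add: com_def proj_simps)
    have 3: "\<xi> (\<xi> a) = proj ((a \<star> e') \<star> e')"
      using a by (simp add: \<xi>_def proj_mult_left BV e'V proj_simps)
    have "proj ((e' \<star> a) \<star> e' - e' \<star> (a \<star> e')) = proj ((a \<star> e') \<star> e' - a \<star> (e' \<star> e'))"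
      by (simp only: left_symmetric)
    then have 4: "proj (a \<star> (e' \<star> e')) =
        proj ((a \<star> e') \<star> e') - proj ((e' \<star> a) \<star> e') + proj (e' \<star> (a \<star> e'))"
      by (simp add: proj_simps algebra_simps)
    show ?thesis unfolding 1 2 3 b\<^sub>0_def 4 by simp
  qed
  moreover have "proj (a \<star> \<xi> b) - \<xi> (proj (a \<star> b)) =
      proj (D a \<star> b) + proj (a \<star> D b) - D (proj (a \<star> b))" if "a \<in> B" "b \<in> B" for a b
  proof -
    have aV: "a \<in> V" "b \<in> V" using that BV by auto
    have "proj (a \<star> \<xi> b) - \<xi> (proj (a \<star> b)) = - proj (a \<star> (b \<star> e')) + proj ((a \<star> b) \<star> e')"
      using aV e'V by (simp add: \<xi>_def proj_mult_left proj_mult_right proj_simps)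
    moreover have "proj (D a \<star> b) = proj (e' \<star> (a \<star> b)) - proj (a \<star> (e' \<star> b))"
      using aV e'V by (simp add: D_def proj_mult_left com_mult proj_simps)
    moreover have "proj (a \<star> D b) = proj (a \<star> (e' \<star> b)) - proj (a \<star> (b \<star> e'))"
      using aV e'V by (simp add: D_def proj_mult_right) (simp add: com_def proj_simps)
    moreover have "D (proj (a \<star> b)) = proj (e' \<star> (a \<star> b)) - proj ((a \<star> b) \<star> e')"
      using aV e'V by (simp add: D_def proj_com) (simp add: com_def proj_simps)
    ultimately show ?thesis by simp
  qed
  ultimately show ?thesis
    unfolding admissible_def
    using linear_betweenI[OF linear_xi, of B B] linear_betweenI[OF linear_D, of B B] xiB DB b0B
    by (simp add: reduction_levi_civita)
qed

lemma D_nilpotent: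
  assumes "\<And>w. w \<in> V \<Longrightarrow> (com e' ^^ k) w = 0"
  shows "nilpotent_endo B D"
proof -
  have "(D ^^ j) a = proj ((com e' ^^ j) a) \<and> (com e' ^^ j) a \<in> V \<and> \<langle>(com e' ^^ j) a, e\<rangle> = 0"
    if a: "a \<in> B" for a j
  proof (induction j)
    case 0
    show ?case using a by (simp add: proj_id) (simp add: B_def)
  next
    case (Suc j)
    then show ?case using e'V by (simp add: D_def proj_com)
  qed
  then show ?thesis using assms BV unfolding nilpotent_endo_def
    by (metis linear_0[OF linear_proj])
qed

lemma xi_adjoint_pairing:
  assumes "a \<in> V" "b \<in> B"
  shows "\<langle>adjoint_endo reduction \<xi> a, b\<rangle> = \<langle>a, \<xi> b\<rangle>"
proof -
  obtain S where S: "finite S" "B = span S" using finite_span_B by blast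
  have "linear (\<lambda>b. \<langle>a, \<xi> b\<rangle>)"
    using linear_compose[OF linear_xi form_linear_right] by (simp add: o_def)
  from represent_functional[OF subspace_B S(2,1) nondegenerate_B this]
  obtain x where x: "x \<in> B" "\<And>y. y \<in> B \<Longrightarrow> \<langle>x, y\<rangle> = \<langle>a, \<xi> y\<rangle>" by metis
  have "adjoint_endo reduction \<xi> a = x"
    unfolding adjoint_endo_def reduction_simps
  proof (rule the_equality)
    fix y assume y: "y \<in> B \<and> (\<forall>b\<in>B. \<langle>y, b\<rangle> = \<langle>a, \<xi> b\<rangle>)"
    then have "\<forall>b\<in>B. \<langle>y - x, b\<rangle> = 0" using x by simp
    moreover have "y - x \<in> B" using x y subspace_B subspace_diff by blast
    ultimately have "y - x = 0" using nondegenerate_B unfolding nondegenerate_on_def by blast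
    then show "y = x" by simp
  qed (use x in auto)
  then show ?thesis using x assms by simp
qed

text \<open>
  In the bracket of \<open>\<real>e \<oplus> B \<oplus> \<real>e'\<close> only the \<open>e\<close>-component needs an argument. It is found by pairing with
  \<open>e'\<close>: \<open>\<langle>[a, a'], e'\<rangle> = \<langle>a, a' \<star> e'\<rangle> - \<langle>a', a \<star> e'\<rangle>\<close> and \<open>\<langle>[e', a], e'\<rangle> = - \<langle>a, e' \<star> e'\<rangle>\<close>.
\<close>

theorem isometric_to_double_extension:
  "isometrically_isomorphic alg (double_extension reduction \<xi> D 0 b\<^sub>0)"
proof -
  define \<phi> where "\<phi> x = (\<langle>x, e'\<rangle>, proj x, \<langle>x, e\<rangle>)" for x
  have lin: "linear_between V (UNIV \<times> B \<times> UNIV) \<phi>"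
    by (simp add: linear_between_def \<phi>_def proj_simps)
  have bij: "bij_betw \<phi> V (UNIV \<times> B \<times> UNIV)"
  proof (rule bij_betwI[where g = "\<lambda>(s, a, t). s *\<^sub>R e + a + t *\<^sub>R e'"])
    show "(\<lambda>(s, a, t). s *\<^sub>R e + a + t *\<^sub>R e') \<in> UNIV \<times> B \<times> UNIV \<rightarrow> V"
      using eV e'V BV by auto
    show "(case \<phi> x of (s, a, t) \<Rightarrow> s *\<^sub>R e + a + t *\<^sub>R e') = x" for x
      using decompose[of x] by (simp add: \<phi>_def algebra_simps)
    show "\<phi> (case y of (s, a, t) \<Rightarrow> s *\<^sub>R e + a + t *\<^sub>R e') = y" if "y \<in> UNIV \<times> B \<times> UNIV" for y
      using that by (auto simp: \<phi>_def proj_def) (auto simp: B_def)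
  qed (auto simp: \<phi>_def)
  have brk: "\<phi> (com u v) = bracket (double_extension reduction \<xi> D 0 b\<^sub>0) (\<phi> u) (\<phi> v)"
    if u: "u \<in> V" and v: "v \<in> V" for u v
  proof -
    let ?a = "proj u" and ?a' = "proj v" and ?t = "\<langle>u, e\<rangle>" and ?t' = "\<langle>v, e\<rangle>"
    have aB: "?a \<in> B" "?a' \<in> B" using u v by simp_all
    have aV: "?a \<in> V" "?a' \<in> V" using u v by simp_all
    have "com u v = com (?a + \<langle>u, e'\<rangle> *\<^sub>R e + ?t *\<^sub>R e') (?a' + \<langle>v, e'\<rangle> *\<^sub>R e + ?t' *\<^sub>R e')"
      using arg_cong2[OF decompose[of u] decompose[of v], of com] .
    also have "\<dots> = ?t *\<^sub>R com e' ?a' - ?t' *\<^sub>R com e' ?a + com ?a ?a'"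
      using aV eV e'V com_anti[of ?a e'] by (simp add: com_linear_simps)
    finally have uv: "com u v = ?t *\<^sub>R com e' ?a' - ?t' *\<^sub>R com e' ?a + com ?a ?a'" .
    have com_e': "\<langle>com e' x, e'\<rangle> = - \<langle>b\<^sub>0, x\<rangle>" for x
      using mult_self_pairing[of x e'] mult_skew[of e' x e'] form_sym[of x "e' \<star> e'"]
      by (simp add: com_def b\<^sub>0_def)
    have "\<langle>com ?a ?a', e'\<rangle> = - \<langle>?a', ?a \<star> e'\<rangle> + \<langle>?a, ?a' \<star> e'\<rangle>"
      by (simp add: com_def mult_skew[of _ _ e'])
    also have "\<dots> = \<langle>\<xi> ?a - adjoint_endo reduction \<xi> ?a, ?a'\<rangle>"
    proof -
      have "\<langle>\<xi> ?a, ?a'\<rangle> = - \<langle>?a', ?a \<star> e'\<rangle>"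
        using proj_pairing[OF aB(2), of "?a \<star> e'"] form_sym[of ?a' "?a \<star> e'"] by (simp add: \<xi>_def)
      moreover have "\<langle>adjoint_endo reduction \<xi> ?a, ?a'\<rangle> = - \<langle>?a, ?a' \<star> e'\<rangle>"
        using xi_adjoint_pairing[OF aV(1) aB(2)] proj_pairing[OF aB(1), of "?a' \<star> e'"]
          form_sym[of ?a "?a' \<star> e'"] form_sym[of ?a "proj (?a' \<star> e')"] by (simp add: \<xi>_def)
      ultimately show ?thesis by simp
    qed
    finally have "\<langle>com ?a ?a', e'\<rangle> = \<langle>\<xi> ?a - adjoint_endo reduction \<xi> ?a, ?a'\<rangle>" .
    then have "\<langle>com u v, e'\<rangle> = - ?t * \<langle>b\<^sub>0, ?a'\<rangle> + ?t' * \<langle>b\<^sub>0, ?a\<rangle> +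
        \<langle>\<xi> ?a - adjoint_endo reduction \<xi> ?a, ?a'\<rangle>"
      unfolding uv by (simp add: com_e')
    moreover have "proj (com u v) = ?t *\<^sub>R D ?a' - ?t' *\<^sub>R D ?a + proj (com ?a ?a')"
      unfolding uv by (simp add: D_def proj_simps)
    moreover have "\<langle>com u v, e\<rangle> = 0" using u v by simp
    ultimately show ?thesis by (simp add: \<phi>_def double_extension_def)
  qed
  have frm: "form (double_extension reduction \<xi> D 0 b\<^sub>0) (\<phi> u) (\<phi> v) = \<langle>u, v\<rangle>" for u v
    by (simp add: \<phi>_def double_extension_def)
      (simp add: proj_def form_sym[of e v] form_sym[of e' v])
  have "carrier (double_extension reduction \<xi> D 0 b\<^sub>0) = UNIV \<times> B \<times> UNIV"
    by (simp add: double_extension_def)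
  then show ?thesis
    unfolding isometrically_isomorphic_def using lin bij brk frm
    by (intro exI[of _ \<phi>]) simp
qed

end

text \<open>
  Nondegeneracy provides \<open>z\<close> with \<open>\<langle>e, z\<rangle> = 1\<close>, and subtracting a multiple of \<open>e\<close> makes it null.
\<close>

theorem (in nilpotent_flat_algebra) double_extension_of_lorentzian:
  assumes "signature_basis V N P" "card N = 2" "P \<noteq> {}"
  shows "\<exists>(B :: 'a form_lie_algebra) \<xi> D \<mu> b0.
           pseudo_euclidean_lie_algebra B \<and> flat B \<and> nilpotent_lie_algebra B \<and> lorentzian B \<and>
           admissible B \<xi> D \<mu> b0 \<and> \<mu> = 0 \<and> nilpotent_endo (carrier B) D \<and>
           isometrically_isomorphic alg (double_extension B \<xi> D \<mu> b0)"
proof -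
  obtain e where e: "e \<in> V" "e \<noteq> 0" "\<langle>e, e\<rangle> = 0"
    "\<And>u. u \<in> V \<Longrightarrow> u \<star> e = 0" "\<And>u. u \<in> V \<Longrightarrow> e \<star> u = 0"
    using null_annihilator_exists[OF assms] by metis
  obtain y where y: "y \<in> V" "\<langle>e, y\<rangle> \<noteq> 0" using eq_zeroI e(1,2) by blast
  define z where "z = (1 / \<langle>e, y\<rangle>) *\<^sub>R y"
  define e' where "e' = z - (\<langle>z, z\<rangle> / 2) *\<^sub>R e"
  have z: "z \<in> V" "\<langle>e, z\<rangle> = 1" "\<langle>z, e\<rangle> = 1" using y form_sym[of z e] by (simp_all add: z_def)
  interpret null_reduction F V mult e e'
    by unfold_locales (use e z in \<open>simp_all add: e'_def\<close>)
  obtain k where "\<And>w. w \<in> V \<Longrightarrow> (com e' ^^ k) w = 0" using ad_nilpotent e'V by metis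
  then have "nilpotent_endo (carrier reduction) D"
    unfolding reduction_simps by (rule D_nilpotent)
  then show ?thesis
    using reduction_pseudo_euclidean reduction_flat reduction_nilpotent[OF nilpotent]
      reduction_lorentzian[OF assms(1,2)] reduction_admissible isometric_to_double_extension
    by blast
qed

section \<open>Extension of the operations to the ambient space\<close>

lemma linear_projection_exists:
  assumes "subspace V"
  obtains pr :: "'a::real_vector \<Rightarrow> 'a" where "linear pr" "\<And>x. pr x \<in> V" "\<And>x. x \<in> V \<Longrightarrow> pr x = x"
proof -
  obtain I where I: "I \<subseteq> V" "independent I" "V \<subseteq> span I"
    using maximal_independent_subset[of V] by blast
  then have sp: "span I = V" using assms by (simp add: span_minimal subset_antisym)
  obtain g where g: "linear g" "\<forall>x\<in>I. g x = x" "range g = span ((\<lambda>x. x) ` I)"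
    using linear_independent_extend_subspace[OF I(2), of "\<lambda>x. x"] by blast
  have "g x = x" if "x \<in> V" for x
    using linear_eq_on_span[OF g(1), of "\<lambda>x. x" I x] g(2) that sp by (simp add: linear_iff)
  then show ?thesis using that[of g] g sp by auto
qed

lemma lower_central_cong:
  assumes "carrier G = carrier H"
    and br: "\<And>x y. x \<in> carrier G \<Longrightarrow> y \<in> carrier G \<Longrightarrow> bracket G x y = bracket H x y"
    and sub: "subspace (carrier G)"
    and closed: "\<And>x y. x \<in> carrier G \<Longrightarrow> y \<in> carrier G \<Longrightarrow> bracket G x y \<in> carrier G"
  shows "lower_central G k = lower_central H k \<and> lower_central G k \<subseteq> carrier G"
proof (induction k)
  case 0
  then show ?case using assms(1) by simp
next
  case (Suc k)
  have "{bracket G x y |x y. x \<in> carrier G \<and> y \<in> lower_central G k} =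
      {bracket H x y |x y. x \<in> carrier H \<and> y \<in> lower_central H k}"
    using Suc br assms(1) by (metis (no_types, opaque_lifting) subsetD)
  moreover have "{bracket G x y |x y. x \<in> carrier G \<and> y \<in> lower_central G k} \<subseteq> carrier G"
    using Suc closed by blast
  ultimately show ?case using sub by (simp add: span_minimal)
qed

lemma levi_civita_cong:
  assumes "carrier G = carrier H"
    and "\<And>x y. x \<in> carrier G \<Longrightarrow> y \<in> carrier G \<Longrightarrow> bracket G x y = bracket H x y"
    and "\<And>x y. x \<in> carrier G \<Longrightarrow> y \<in> carrier G \<Longrightarrow> form G x y = form H x y"
    and "\<And>x y. x \<in> carrier G \<Longrightarrow> y \<in> carrier G \<Longrightarrow> bracket G x y \<in> carrier G"
    and "u \<in> carrier G" "v \<in> carrier G"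
  shows "levi_civita G u v = levi_civita H u v"
  unfolding levi_civita_def
proof (rule arg_cong[where f = The], rule ext)
  fix x
  show "(x \<in> carrier G \<and> (\<forall>w\<in>carrier G. 2 * form G x w =
      form G (bracket G u v) w + form G (bracket G w u) v + form G (bracket G w v) u)) \<longleftrightarrow>
    (x \<in> carrier H \<and> (\<forall>w\<in>carrier H. 2 * form H x w =
      form H (bracket H u v) w + form H (bracket H w u) v + form H (bracket H w v) u))"
    using assms by auto
qed

lemma bilinear_between_extend:
  assumes "bilinear_between V W f" "linear pr" "\<And>x. pr x \<in> V"
  shows "bilinear (\<lambda>x y. f (pr x) (pr y))"
proof -
  have "f x (y + z) = f x y + f x z" "f (x + y) z = f x z + f y z"
    if "x \<in> V" "y \<in> V" "z \<in> V" for x y z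
    using assms(1) that by (simp_all add: bilinear_between_def linear_between_def)
  moreover have "f x (c *\<^sub>R y) = c *\<^sub>R f x y" "f (c *\<^sub>R x) y = c *\<^sub>R f x y"
    if "x \<in> V" "y \<in> V" for x y c
    using assms(1) that by (simp_all add: bilinear_between_def linear_between_def)
  ultimately show ?thesis
    using assms(3)
    by (simp add: bilinear_def linear_iff linear_add[OF assms(2)] linear_scale[OF assms(2)])
qed

text \<open>
  Form and bracket are composed with a linear projection onto the carrier. The product is defined by
  Koszul's formula for these extended operations; it also factors through the projection, so skewness and
  left symmetry hold for all vectors.
\<close>

theorem extend_to_nilpotent_flat_algebra:
  fixes G :: "'a::real_vector form_lie_algebra"
  assumes pe: "pseudo_euclidean_lie_algebra G" and fl: "flat G" and nil: "nilpotent_lie_algebra G"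
  obtains F mult where "nilpotent_flat_algebra F (carrier G) mult"
    "\<And>u v. u \<in> carrier G \<Longrightarrow> v \<in> carrier G \<Longrightarrow> F u v = form G u v"
    "\<And>u v. u \<in> carrier G \<Longrightarrow> v \<in> carrier G \<Longrightarrow> mult u v - mult v u = bracket G u v"
proof -
  define V where "V = carrier G"
  have sub: "subspace V" and ex: "\<exists>S. finite S \<and> span S = V"
    and lie: "lie_algebra_on V (bracket G)" and bil: "bilinear_between V UNIV (form G)"
    and sym: "\<And>u v. u \<in> V \<Longrightarrow> v \<in> V \<Longrightarrow> form G u v = form G v u"
    and nd: "\<And>u. u \<in> V \<Longrightarrow> \<forall>v\<in>V. form G u v = 0 \<Longrightarrow> u = 0"
    using pe by (auto simp: pseudo_euclidean_lie_algebra_def finite_dimensional_def V_def)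
  obtain S where S: "finite S" "span S = V" using ex by blast
  obtain pr where pr: "linear pr" "\<And>x. pr x \<in> V" "\<And>x. x \<in> V \<Longrightarrow> pr x = x"
    using linear_projection_exists[OF sub] by metis
  have pr_pr [simp]: "pr (pr x) = pr x" for x using pr by simp
  have bbr: "bilinear_between V V (bracket G)" using lie by (simp add: lie_algebra_on_def)
  then have closed: "bracket G x y \<in> V" if "x \<in> V" "y \<in> V" for x y
    using that by (simp add: bilinear_between_def linear_between_def)
  define F where "F x y = form G (pr x) (pr y)" for x y
  define br where "br x y = bracket G (pr x) (pr y)" for x y
  have bilF: "bilinear F" unfolding F_def using bilinear_between_extend[OF bil pr(1,2)] .
  have bilbr: "bilinear br" unfolding br_def using bilinear_between_extend[OF bbr pr(1,2)] .
  interpret symmetric_form F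
    by unfold_locales (use bilF sym pr(2) in \<open>simp_all add: F_def\<close>)
  have F_pr [simp]: "F (pr x) y = F x y" "F x (pr y) = F x y" for x y by (simp_all add: F_def)
  have br_pr [simp]: "br (pr x) y = br x y" "br x (pr y) = br x y" for x y by (simp_all add: br_def)
  have brV [simp]: "br x y \<in> V" for x y unfolding br_def using closed pr(2) by blast
  have br_anti: "br x y = - br y x" for x y
  proof -
    have "br z z = 0" for z
      using lie pr(2) by (simp add: br_def lie_algebra_on_def)
    from this[of "x + y"] this[of x] this[of y] show ?thesis
      by (simp add: bilinear_ladd[OF bilbr] bilinear_radd[OF bilbr] eq_neg_iff_add_eq_0 add.commute)
  qed
  have nondeg: "nondegenerate_on V"
    unfolding nondegenerate_on_def using nd pr(3) by (simp add: F_def)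
  have zero: "x = 0" if "x \<in> V" "\<And>w. F x w = 0" for x
    using nondeg that by (simp add: nondegenerate_on_def)
  define K where "K u v w = F (br u v) w + F (br w u) v + F (br w v) u" for u v w
  have K_pr: "K (pr u) v w = K u v w" "K u (pr v) w = K u v w" "K u v (pr w) = K u v w" for u v w
    by (simp_all add: K_def)
  note bil_simps =
    bilinear_ladd[OF bilbr] bilinear_radd[OF bilbr] bilinear_lmul[OF bilbr] bilinear_rmul[OF bilbr]
  have "\<exists>x. x \<in> V \<and> (\<forall>w. 2 * F x w = K u v w)" for u v
  proof -
    have "linear (\<lambda>w. K u v w / 2)"
      by (rule linearI) (simp_all add: K_def bil_simps add_divide_distrib algebra_simps)
    from represent_functional[OF sub S(2)[symmetric] S(1) nondeg this]
    obtain x where x: "x \<in> V" "\<And>y. y \<in> V \<Longrightarrow> F x y = K u v y / 2" by metis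
    have "2 * F x w = K u v w" for w using x(2)[OF pr(2), of w] by (simp add: K_pr)
    then show ?thesis using x by blast
  qed
  then obtain mult where mV: "\<And>u v. mult u v \<in> V" and m: "\<And>u v w. 2 * F (mult u v) w = K u v w"
    by metis
  have mult_eqI: "mult u v = x" if "x \<in> V" "\<And>w. 2 * F x w = K u v w" for u v x
  proof -
    have "F (mult u v - x) w = 0" for w
    proof -
      have "2 * F (mult u v) w = 2 * F x w" unfolding m that(2) ..
      then show ?thesis by simp
    qed
    then have "mult u v - x = 0" using zero[of "mult u v - x"] mV that(1) sub by (simp add: subspace_diff)
    then show ?thesis by simp
  qed
  have mult_pr: "mult (pr u) v = mult u v" "mult u (pr v) = mult u v" for u v
    by (rule mult_eqI, rule mV, simp add: m K_pr)+
  have "bilinear mult"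
    unfolding bilinear_def
  proof (intro conjI allI linearI)
    show "mult u (v + v') = mult u v + mult u v'" for u v v'
      by (rule mult_eqI) (simp_all add: mV sub subspace_add distrib_left m, simp add: K_def bil_simps)
    show "mult u (r *\<^sub>R v) = r *\<^sub>R mult u v" for u r v
      by (rule mult_eqI) (simp_all add: mV sub subspace_scale mult.left_commute[of 2] m,
          simp add: K_def bil_simps algebra_simps)
    show "mult (v + v') u = mult v u + mult v' u" for u v v'
      by (rule mult_eqI) (simp_all add: mV sub subspace_add distrib_left m, simp add: K_def bil_simps)
    show "mult (r *\<^sub>R v) u = r *\<^sub>R mult v u" for u r v
      by (rule mult_eqI) (simp_all add: mV sub subspace_scale mult.left_commute[of 2] m,
          simp add: K_def bil_simps algebra_simps)
  qed
  moreover have skew: "F (mult u v) w = - F v (mult u w)" for u v w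
  proof -
    have "F (br v w) u + F (br w v) u = 0" "F (br w u) v + F (br u w) v = 0" "F (br v u) w + F (br u v) w = 0"
      using br_anti[of v w] br_anti[of w u] br_anti[of v u] by simp_all
    then have "K u v w + K u w v = 0" unfolding K_def by linarith
    then have "2 * F (mult u v) w + 2 * F (mult u w) v = 0" unfolding m .
    then show ?thesis using form_sym[of v "mult u w"] by simp
  qed
  moreover have lc: "levi_civita G u v = mult u v" if uv: "u \<in> V" "v \<in> V" for u v
  proof -
    have "levi_civita G u v = levi_civita \<lparr>carrier = V, bracket = br, form = F\<rparr> u v"
      by (rule levi_civita_cong) (use uv closed pr(3) in \<open>simp_all add: V_def br_def F_def\<close>)
    also have "\<dots> = mult u v"
      by (rule levi_civita_eqI[OF sub nondeg mV]) (simp add: m K_def)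
    finally show ?thesis .
  qed
  have lsym: "mult (mult u v) w - mult u (mult v w) = mult (mult v u) w - mult v (mult u w)" for u v w
  proof -
    have "mult (mult (pr u) (pr v)) (pr w) - mult (pr u) (mult (pr v) (pr w)) =
        mult (mult (pr v) (pr u)) (pr w) - mult (pr v) (mult (pr u) (pr w))"
      using fl pr(2) mV unfolding flat_def V_def[symmetric] by (simp add: lc)
    then show ?thesis by (simp add: mult_pr)
  qed
  ultimately have ax: "flat_metric_algebra F V mult"
    by unfold_locales (use sub ex nondeg mV lsym in auto)
  then interpret flat_metric_algebra F V mult .
  have br_eq: "com u v = br u v" for u v
  proof -
    have "F (com u v - br u v) w = 0" for w
    proof -
      have "F (br v w) u + F (br w v) u = 0" "F (br w u) v + F (br u w) v = 0" "F (br v u) w + F (br u v) w = 0"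
        using br_anti[of v w] br_anti[of w u] br_anti[of v u] by simp_all
      then have "K u v w - K v u w = 2 * F (br u v) w" unfolding K_def by linarith
      then have "2 * F (mult u v) w - 2 * F (mult v u) w = 2 * F (br u v) w" unfolding m .
      then show ?thesis by (simp add: com_def)
    qed
    then have "com u v - br u v = 0" by (intro zero) simp_all
    then show ?thesis by simp
  qed
  have com_eq: "com u v = bracket G u v" if "u \<in> V" "v \<in> V" for u v
    using that br_eq pr(3) by (simp add: br_def)
  have "lower_central G k = lc k" for k
    using lower_central_cong[of G alg k] sub closed com_eq by (simp add: V_def)
  then have "nilpotent_lie_algebra alg" using nil by (simp add: nilpotent_lie_algebra_def)
  then have "nilpotent_flat_algebra F V mult" by unfold_locales
  then show ?thesis
    using that[of F mult] com_eq pr(3) unfolding V_def com_def by (simp add: F_def V_def)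
qed

section \<open>Nilpotent algebras of signature (2, n - 2)\<close>

theorem theorem4p2:
  fixes G :: "'a::real_vector form_lie_algebra" and n :: nat
  assumes "pseudo_euclidean_lie_algebra G"
    and "flat G"
    and "nilpotent_lie_algebra G"
    and "n = dim (carrier G)"
    and "n \<ge> 4"
    and "has_signature G 2 (n - 2)"
  shows "\<exists>(B :: 'a form_lie_algebra) \<xi> D \<mu> b0.
           pseudo_euclidean_lie_algebra B \<and> flat B \<and> nilpotent_lie_algebra B \<and> lorentzian B \<and>
           admissible B \<xi> D \<mu> b0 \<and> \<mu> = 0 \<and> nilpotent_endo (carrier B) D \<and>
           isometrically_isomorphic G (double_extension B \<xi> D \<mu> b0)"
proof -
  obtain F mult where nfa: "nilpotent_flat_algebra F (carrier G) mult"
    and F: "\<And>u v. u \<in> carrier G \<Longrightarrow> v \<in> carrier G \<Longrightarrow> F u v = form G u v"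
    and br: "\<And>u v. u \<in> carrier G \<Longrightarrow> v \<in> carrier G \<Longrightarrow> mult u v - mult v u = bracket G u v"
    using extend_to_nilpotent_flat_algebra[OF assms(1-3)] by metis
  interpret nilpotent_flat_algebra F "carrier G" mult by (rule nfa)
  obtain N P where NP: "finite N" "finite P" "card N = 2" "card P = n - 2"
    "span (N \<union> P) = carrier G"
    "\<forall>u\<in>N \<union> P. \<forall>v\<in>N \<union> P. u \<noteq> v \<longrightarrow> form G u v = 0"
    "\<forall>u\<in>N. form G u u < 0" "\<forall>u\<in>P. form G u u > 0"
    using assms(6) unfolding has_signature_def by (elim exE conjE, intro that)
  have mem: "u \<in> carrier G" if "u \<in> N \<union> P" for u using span_base[OF that] NP(5) by simp
  have "F u v = form G u v" if "u \<in> N \<union> P" "v \<in> N \<union> P" for u v using F mem that by blast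
  then have sb: "signature_basis (carrier G) N P"
    using NP unfolding signature_basis_def orthogonal_family_def by fastforce
  have "P \<noteq> {}" using NP(4) assms(5) by auto
  from double_extension_of_lorentzian[OF sb NP(3) this]
  obtain B :: "'a form_lie_algebra" and \<xi> D \<mu> b0 where *:
    "pseudo_euclidean_lie_algebra B" "flat B" "nilpotent_lie_algebra B" "lorentzian B"
    "admissible B \<xi> D \<mu> b0" "\<mu> = 0" "nilpotent_endo (carrier B) D"
    "isometrically_isomorphic alg (double_extension B \<xi> D \<mu> b0)"
    by blast
  have "isometrically_isomorphic G (double_extension B \<xi> D \<mu> b0)"
    using *(8) F br by (auto simp: isometrically_isomorphic_def com_def)
  then show ?thesis using * by blast
qed

end
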